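(* Let $K$ be a non-archimedean local field with $\mathrm{char}(K)\neq 2$, and let $\pi\colon\mathrm{SL}_2(K)\to\mathrm{PSL}_2(K)$ be the quotient map. There exists a subgroup $G$ of $\mathrm{PSL}_2(K)$ which does not lift to $\mathrm{SL}_2(K)$, and whose non-trivial torsion elements are all unipotent. In particular, $G$ is torsion-free if $\mathrm{char}(K)=0$, and if $\mathrm{char}(K)=p$ then every non-trivial torsion element of $G$ has order $p$.
   Context: A subgroup $G\le\mathrm{PSL}_2(K)$ lifts to $\mathrm{SL}_2(K)$ if there is a homomorphism $\phi\colon G\to\mathrm{SL}_2(K)$ with $\pi\circ\phi=\mathrm{id}_G$. An element of $\mathrm{PSL}_2(K)$ is called unipotent if it is the image of a unipotent matrix of $\mathrm{SL}_2(K)$ (equivalently, its representatives are $\pm$ a unipotent matrix). *)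

theory Defs
  imports "HOL-Analysis.Analysis" "HOL-Algebra.Algebra"
begin

section \<open>Non-archimedean local fields\<close>

text \<open>A non-archimedean local field: a field K together with an absolute value
  that is non-archimedean, discretely valued (and non-trivial), complete, and has
  finite residue field.\<close>

definition nonarch_abs :: "('a::field \<Rightarrow> real) \<Rightarrow> bool" where
  "nonarch_abs v \<longleftrightarrow>
     (\<forall>x. 0 \<le> v x) \<and> (\<forall>x. v x = 0 \<longleftrightarrow> x = 0) \<and>
     (\<forall>x y. v (x * y) = v x * v y) \<and>
     (\<forall>x y. v (x + y) \<le> max (v x) (v y))"

definition discrete_nontrivial_abs :: "('a::field \<Rightarrow> real) \<Rightarrow> bool" where
  "discrete_nontrivial_abs v \<longleftrightarrow>
     (\<exists>u. 0 < v u \<and> v u < 1 \<and> (\<forall>x. x \<noteq> 0 \<longrightarrow> (\<exists>k::int. v x = v u powi k)))"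

definition abs_complete :: "('a::field \<Rightarrow> real) \<Rightarrow> bool" where
  "abs_complete v \<longleftrightarrow>
     (\<forall>f::nat \<Rightarrow> 'a.
        (\<forall>e>0. \<exists>k. \<forall>i\<ge>k. \<forall>j\<ge>k. v (f i - f j) < e) \<longrightarrow>
        (\<exists>l. \<forall>e>0. \<exists>k. \<forall>j\<ge>k. v (f j - l) < e))"

text \<open>Finite residue field: the valuation ring {x. v x \<le> 1} modulo the maximal
  ideal {x. v x < 1} has finitely many classes.\<close>
definition finite_residue_field :: "('a::field \<Rightarrow> real) \<Rightarrow> bool" where
  "finite_residue_field v \<longleftrightarrow>
     (\<exists>S. finite S \<and> S \<subseteq> {x. v x \<le> 1} \<and>
          (\<forall>x. v x \<le> 1 \<longrightarrow> (\<exists>s\<in>S. v (x - s) < 1)))"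

definition nonarch_local_field :: "('a::field \<Rightarrow> real) \<Rightarrow> bool" where
  "nonarch_local_field v \<longleftrightarrow>
     nonarch_abs v \<and> discrete_nontrivial_abs v \<and> abs_complete v \<and> finite_residue_field v"

section \<open>SL_2 and PSL_2\<close>

definition SL2 :: "('a::field ^2^2) monoid" where
  "SL2 = \<lparr>carrier = {A. det A = 1}, mult = (**), one = mat 1\<rparr>"

definition center_pm :: "('a::field ^2^2) set" where
  "center_pm = {mat 1, - mat 1}"

text \<open>PSL_2(K) = SL_2(K) / {+-I}, as the HOL-Algebra quotient group.\<close>
definition PSL2 :: "('a::field ^2^2) set monoid" where
  "PSL2 = SL2 Mod center_pm"

text \<open>The quotient map pi : SL_2(K) -> PSL_2(K).\<close>
definition proj_PSL2 :: "'a::field ^2^2 \<Rightarrow> ('a ^2^2) set" where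
  "proj_PSL2 A = center_pm #>\<^bsub>SL2\<^esub> A"

definition lifts_to_SL2 :: "('a::field ^2^2) set set \<Rightarrow> bool" where
  "lifts_to_SL2 G \<longleftrightarrow>
     (\<exists>\<phi>. \<phi> \<in> hom (PSL2\<lparr>carrier := G\<rparr>) SL2 \<and> (\<forall>g\<in>G. proj_PSL2 (\<phi> g) = g))"

text \<open>A unipotent matrix: A - I is nilpotent.\<close>
definition unipotent_matrix :: "'a::field ^2^2 \<Rightarrow> bool" where
  "unipotent_matrix A \<longleftrightarrow>
     (\<exists>n::nat. ((\<lambda>B. B ** (A - mat 1)) ^^ n) (mat 1) = 0)"

definition unipotent_PSL2 :: "('a::field ^2^2) set \<Rightarrow> bool" where
  "unipotent_PSL2 g \<longleftrightarrow> (\<exists>A\<in>carrier SL2. unipotent_matrix A \<and> proj_PSL2 A = g)"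

definition torsion_PSL2 :: "('a::field ^2^2) set \<Rightarrow> bool" where
  "torsion_PSL2 g \<longleftrightarrow> (\<exists>n::nat. n > 0 \<and> g [^]\<^bsub>PSL2\<^esub> n = \<one>\<^bsub>PSL2\<^esub>)"

end

theory Submission
  imports Defs
begin

text \<open>
  Let \<open>F\<close> be a countable subfield of \<open>K\<close>, let \<open>x\<close> be transcendental over \<open>F\<close> and put
  \<open>s = x + 1/x - 2\<close>. The determinant-one matrices over \<open>F[s]\<close> that are upper unipotent up to sign
  modulo \<open>s\<close> form a group whose torsion elements have constant trace, hence trace \<open>2\<close> or \<open>-2\<close>. It
  contains \<open>[[1, 1], [0, 1]] [[1, 0], [s, 1]]\<close>, a product of two squares with eigenvalues \<open>x\<close> and
  \<open>1/x\<close>; an element fixing one of its eigenlines has an eigenvalue that is a unit of \<open>F[x, 1/x]\<close>,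
  so up to sign it acts on both eigenlines like a power of it. Diagonalising gives a group \<open>H\<^sub>x\<close> in
  which every triangular element is diagonal with entries plus or minus powers of \<open>x\<close>, and in which
  \<open>T = diag(x, 1/x)\<close> is a product of two squares.

  Replacing \<open>x\<close> by \<open>-x\<close> gives a second such group, containing \<open>-T\<close> as a product of two squares, with
  the same triangular elements. Conjugating it by \<open>diag(z, 1)\<close> for a generic \<open>z\<close> makes every
  cyclically reduced word of length at least two in the two groups have an entry of positive degree
  in \<open>z\<close>, so that no torsion is created. A lift to \<open>SL\<^sub>2\<close> would fix products of squares, hence
  send the common image of \<open>T\<close> and \<open>-T\<close> both to \<open>T\<close> and to \<open>-T\<close>.
\<close>

section \<open>Amalgams\<close>

lemma not_successivelyE:
  assumes "\<not> successively P xs"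
  obtains us x y vs where "xs = us @ x # y # vs" "\<not> P x y"
proof -
  have "\<exists>us x y vs. xs = us @ x # y # vs \<and> \<not> P x y"
    using assms
  proof (induction P xs rule: successively.induct)
    case (3 P x y xs)
    then show ?case
      by (metis append_Cons append_Nil successively.simps(3))
  qed auto
  then show thesis using that by blast
qed

context group
begin

abbreviation "list_prod xs \<equiv> foldr (\<otimes>) xs \<one>"

lemma list_prod_closed: "set xs \<subseteq> carrier G \<Longrightarrow> list_prod xs \<in> carrier G"
  by (induction xs) auto

lemma list_prod_append:
  "set xs \<subseteq> carrier G \<Longrightarrow> set ys \<subseteq> carrier G \<Longrightarrow>
    list_prod (xs @ ys) = list_prod xs \<otimes> list_prod ys"
  by (induction xs) (auto simp: m_assoc list_prod_closed)

lemma generate_imp_list_prod: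
  assumes "g \<in> generate G A" "A \<subseteq> carrier G" "\<And>a. a \<in> A \<Longrightarrow> inv a \<in> A"
  shows "\<exists>xs. set xs \<subseteq> A \<and> g = list_prod xs"
  using assms(1)
proof induction
  case one
  show ?case by (rule exI[of _ "[]"]) simp
next
  case (incl h)
  then show ?case using assms(2) by (intro exI[of _ "[h]"]) auto
next
  case (inv h)
  then show ?case using assms(2,3) by (intro exI[of _ "[inv h]"]) auto
next
  case (eng g h)
  then obtain xs ys where "set xs \<subseteq> A" "g = list_prod xs" "set ys \<subseteq> A" "h = list_prod ys"
    by blast
  then show ?case
    using assms(2) by (intro exI[of _ "xs @ ys"]) (auto simp del: foldr_append simp: list_prod_append)
qed

text \<open>Such a word has even length, so it splits into consecutive pairs with first letter in
  \<open>A\<close> and second in \<open>B\<close>; each pair multiplies into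
  \<open>S\<close>.\<close>

lemma alternating_list_prod:
  assumes carr: "A \<subseteq> carrier G" "B \<subseteq> carrier G" and disj: "A \<inter> B = {}"
    and S: "\<And>a b. a \<in> S \<Longrightarrow> b \<in> S \<Longrightarrow> a \<otimes> b \<in> S" "\<And>x y. x \<in> A \<Longrightarrow> y \<in> B \<Longrightarrow> x \<otimes> y \<in> S"
    and xs: "successively (\<lambda>x y. x \<in> A \<and> y \<in> B \<or> x \<in> B \<and> y \<in> A) xs"
      "set xs \<subseteq> carrier G" "xs \<noteq> []" "hd xs \<in> A" "last xs \<in> B"
  shows "list_prod xs \<in> S"
  using xs
proof (induction xs rule: induct_list012)
  case (3 x y zs)
  then have xy: "x \<in> A" "y \<in> B" using disj by auto
  show ?case
  proof (cases zs)
    case Nil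
    then show ?thesis using S(2)[OF xy] xy carr by (simp add: subset_iff)
  next
    case (Cons z ws)
    have zs: "list_prod zs \<in> carrier G" using 3 by (intro list_prod_closed) auto
    have "z \<in> A" using 3 xy Cons disj by auto
    then have "list_prod zs \<in> S" using 3 Cons by (cases ws) auto
    then have "(x \<otimes> y) \<otimes> list_prod zs \<in> S" using S xy by blast
    then show ?thesis using xy carr zs by (simp add: m_assoc subset_iff)
  qed
qed (use disj in auto)

text \<open>Cyclically reducing a word in \<open>H1 \<union> H2\<close> either shortens it to at most one letter or makes it
  alternate between \<open>H1 - H2\<close> and \<open>H2 - H1\<close>.\<close>
lemma generate_union_conj:
  assumes H: "subgroup H1 G" "subgroup H2 G"
    and S: "\<And>a b. a \<in> S \<Longrightarrow> b \<in> S \<Longrightarrow> a \<otimes> b \<in> S"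
      "\<And>x y. x \<in> H1 - H2 \<Longrightarrow> y \<in> H2 - H1 \<Longrightarrow> x \<otimes> y \<in> S"
    and g: "g \<in> generate G (H1 \<union> H2)"
  shows "\<exists>k\<in>carrier G. inv k \<otimes> g \<otimes> k \<in> H1 \<union> H2 \<union> S"
proof -
  interpret H1: subgroup H1 G by fact
  interpret H2: subgroup H2 G by fact
  let ?alt = "\<lambda>x y. x \<in> H1 - H2 \<and> y \<in> H2 - H1 \<or> x \<in> H2 - H1 \<and> y \<in> H1 - H2"
  let ?good = "\<lambda>g. \<exists>k\<in>carrier G. inv k \<otimes> g \<otimes> k \<in> H1 \<union> H2 \<union> S"
  have carr: "H1 \<union> H2 \<subseteq> carrier G"
    using H1.subset H2.subset by simp
  have good_self: "?good g" if "g \<in> H1 \<union> H2 \<union> S" "g \<in> carrier G" for g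
    using that by (intro bexI[of _ \<one>]) auto
  have good_conj: "?good (x \<otimes> y)" if "?good (y \<otimes> x)" and xy: "x \<in> carrier G" "y \<in> carrier G" for x y
  proof -
    obtain k where k: "k \<in> carrier G" "inv k \<otimes> (y \<otimes> x) \<otimes> k \<in> H1 \<union> H2 \<union> S"
      using \<open>?good (y \<otimes> x)\<close> by auto
    have "inv (x \<otimes> k) \<otimes> (x \<otimes> y) \<otimes> (x \<otimes> k) = inv k \<otimes> (y \<otimes> x) \<otimes> k"
    proof -
      have "inv x \<otimes> (x \<otimes> w) = w" if "w \<in> carrier G" for w
        using that xy by (simp flip: m_assoc)
      then show ?thesis
        using k(1) xy by (simp add: inv_mult_group m_assoc)
    qed
    then show ?thesis
      using k xy by (intro bexI[of _ "x \<otimes> k"]) auto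
  qed
  have "?good (list_prod xs)" if "set xs \<subseteq> H1 \<union> H2" for xs
    using that
  proof (induction "length xs" arbitrary: xs rule: less_induct)
    case less
    \<comment> \<open>Two neighbours that do not alternate lie together in \<open>H1\<close> or
      together in \<open>H2\<close>, so they merge into one letter.\<close>
    have shorten: "?good (list_prod ws)"
      if ws: "set ws \<subseteq> H1 \<union> H2" "length ws = length xs" "\<not> successively ?alt ws" for ws
    proof -
      obtain us x y vs where eq: "ws = us @ x # y # vs" and xy: "\<not> ?alt x y"
        using not_successivelyE[OF ws(3)] by metis
      have "x \<otimes> y \<in> H1 \<union> H2"
        using xy ws(1) by (auto simp: eq)
      then have "?good (list_prod (us @ (x \<otimes> y) # vs))"
        using ws by (intro less.hyps) (auto simp: eq)
      moreover have "list_prod (us @ (x \<otimes> y) # vs) = list_prod ws"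
      proof -
        have "set us \<subseteq> carrier G" "set vs \<subseteq> carrier G" "x \<in> carrier G" "y \<in> carrier G"
          using ws(1) carr by (auto simp: eq)
        then show ?thesis
          by (simp add: eq list_prod_append m_assoc list_prod_closed del: foldr_append)
      qed
      ultimately show ?thesis by simp
    qed
    have alt: "list_prod ws \<in> S"
      if "successively ?alt ws" "set ws \<subseteq> carrier G" "ws \<noteq> []" "hd ws \<in> H1 - H2" "last ws \<in> H2 - H1" for ws
      by (rule alternating_list_prod[where A = "H1 - H2" and B = "H2 - H1"])
        (use that S carr in auto)
    show ?case
    proof (cases "length xs \<le> 1")
      case True
      then obtain x where "xs = [] \<or> xs = [x]"
        by (metis One_nat_def Suc_length_conv le_Suc_eq le_zero_eq length_0_conv)
      then show ?thesis
        using less.prems carr by (intro good_self) auto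
    next
      case False
      then obtain x ys where xs: "xs = x # ys" "ys \<noteq> []"
        by (cases xs) auto
      have in_carr: "x \<in> carrier G" "set ys \<subseteq> carrier G"
        using less.prems carr by (auto simp: xs)
      let ?zs = "ys @ [x]"
      \<comment> \<open>Moving the first letter to the end is a conjugation.\<close>
      have rot: "?good (list_prod xs)" if "?good (list_prod ?zs)"
      proof -
        have "?good (list_prod ys \<otimes> x)"
          using that in_carr by (simp add: list_prod_append del: foldr_append)
        then have "?good (x \<otimes> list_prod ys)"
          by (rule good_conj) (use in_carr list_prod_closed in auto)
        then show ?thesis by (simp add: xs)
      qed
      consider "\<not> successively ?alt xs" | "\<not> successively ?alt ?zs"
        | "successively ?alt xs" "successively ?alt ?zs" by blast
      then show ?thesis
      proof cases
        case 1
        then show ?thesis using shorten less.prems by blast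
      next
        case 2
        then show ?thesis using shorten[of ?zs] less.prems xs rot by auto
      next
        case 3
        \<comment> \<open>The word alternates cyclically, so whichever of \<open>xs\<close> and
          \<open>?zs\<close> begins in \<open>H1 - H2\<close> ends in
          \<open>H2 - H1\<close>.\<close>
        have last: "?alt (last ys) x" using 3(2) xs by (auto simp: successively_append_iff)
        have hd: "?alt x (hd ys)" using 3(1) xs by (cases ys) auto
        show ?thesis
        proof (cases "x \<in> H1")
          case True
          then have "list_prod xs \<in> S"
            using last hd xs 3(1) in_carr by (intro alt) auto
          then show ?thesis
            using good_self in_carr list_prod_closed[of xs] by (simp add: xs)
        next
          case False
          then have "list_prod ?zs \<in> S"
            using last hd xs 3(2) in_carr by (intro alt) auto
          then have "?good (list_prod ?zs)"
            using in_carr by (intro good_self list_prod_closed) auto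
          then show ?thesis by (rule rot)
        qed
      qed
    qed
  qed
  moreover have "\<exists>xs. set xs \<subseteq> H1 \<union> H2 \<and> g = list_prod xs"
    by (rule generate_imp_list_prod[OF g carr]) auto
  ultimately show ?thesis by blast
qed

end

section \<open>Two-by-two matrices\<close>

definition mat2 :: "'a \<Rightarrow> 'a \<Rightarrow> 'a \<Rightarrow> 'a \<Rightarrow> 'a^2^2" where
  "mat2 a b c d = (\<chi> i j. if i = 1 then (if j = 1 then a else b) else (if j = 1 then c else d))"

lemma mat2_nth [simp]:
  "mat2 a b c d $ 1 $ 1 = a" "mat2 a b c d $ 1 $ 2 = b"
  "mat2 a b c d $ 2 $ 1 = c" "mat2 a b c d $ 2 $ 2 = d"
  by (simp_all add: mat2_def)

lemma mat2_eqI: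
  "A $ 1 $ 1 = B $ 1 $ 1 \<Longrightarrow> A $ 1 $ 2 = B $ 1 $ 2 \<Longrightarrow> A $ 2 $ 1 = B $ 2 $ 1 \<Longrightarrow> A $ 2 $ 2 = B $ 2 $ 2
    \<Longrightarrow> A = (B :: 'a^2^2)"
  by (simp add: vec_eq_iff forall_2)

lemma mat2_eq_iff [simp]:
  "mat2 a b c d = mat2 a' b' c' d' \<longleftrightarrow> a = a' \<and> b = b' \<and> c = c' \<and> d = d'"
  by (metis mat2_nth)

lemma mat2_cases [cases type]:
  fixes A :: "'a^2^2"
  obtains a b c d where "A = mat2 a b c d"
  by (rule that[of "A$1$1" "A$1$2" "A$2$1" "A$2$2"]) (rule mat2_eqI; simp)

lemma mat2_mult [simp]:
  "mat2 a b c d ** mat2 a' b' c' d' =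
     mat2 (a * a' + b * c') (a * b' + b * d') (c * a' + d * c') (c * b' + d * d' :: 'a::field)"
  by (rule mat2_eqI) (simp_all add: matrix_matrix_mult_def sum_2)

lemma det_mat2 [simp]: "det (mat2 a b c d) = a * d - b * (c :: 'a::field)"
  by (simp add: det_2)

lemma mat_1_mat2: "mat 1 = mat2 1 0 0 (1 :: 'a::field)"
  by (rule mat2_eqI) (simp_all add: mat_def)

lemma uminus_mat2 [simp]: "- mat2 a b c d = mat2 (-a) (-b) (-c) (- d :: 'a::field)"
  by (rule mat2_eqI) simp_all

lemma minus_mat2 [simp]:
  "mat2 a b c d - mat2 a' b' c' d' = mat2 (a - a') (b - b') (c - c') (d - d' :: 'a::field)"
  by (rule mat2_eqI) simp_all

lemma uminus_mult_mat2:
  "(- A) ** B = - ((A :: 'a::field^2^2) ** (B :: 'a^2^2))" "A ** (- B) = - (A ** B)"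
  by (cases A; cases B; simp)+

lemma zero_mat2: "0 = mat2 0 0 0 (0 :: 'a::field)"
  by (rule mat2_eqI) simp_all

definition tr2 :: "'a::field^2^2 \<Rightarrow> 'a" where
  "tr2 A = A $ 1 $ 1 + A $ 2 $ 2"

lemma tr2_mat2 [simp]: "tr2 (mat2 a b c d) = a + d"
  by (simp add: tr2_def)

lemma tr2_mult_commute: "tr2 ((A :: 'a::field^2^2) ** B) = tr2 (B ** A)"
  by (cases A; cases B) (simp add: algebra_simps)

lemma tr2_uminus [simp]: "tr2 (- A) = - tr2 A"
  by (simp add: tr2_def)

section \<open>The groups $SL_2$ and $PSL_2$\<close>

lemma carrier_SL2 [simp]: "A \<in> carrier SL2 \<longleftrightarrow> det A = 1"
  and mult_SL2 [simp]: "A \<otimes>\<^bsub>SL2\<^esub> B = A ** B"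
  and one_SL2 [simp]: "\<one>\<^bsub>SL2\<^esub> = mat 1"
  by (simp_all add: SL2_def)

lemma group_SL2: "group (SL2 :: ('a::field^2^2) monoid)"
proof (rule groupI)
  fix A :: "'a^2^2" assume A: "A \<in> carrier SL2"
  obtain a b c d where [simp]: "A = mat2 a b c d" by (cases A)
  show "\<exists>B\<in>carrier SL2. B \<otimes>\<^bsub>SL2\<^esub> A = \<one>\<^bsub>SL2\<^esub>"
    using A by (intro bexI[of _ "mat2 d (-b) (-c) a"]) (auto simp: mat_1_mat2 algebra_simps)
qed (auto simp: det_mul matrix_mul_assoc)

interpretation SL2: group "SL2 :: ('a::field^2^2) monoid"
  by (rule group_SL2)

lemma inv_SL2_mat2:
  "a * d - b * c = 1 \<Longrightarrow> inv\<^bsub>SL2\<^esub> mat2 a b c d = mat2 d (-b) (-c) (a :: 'a::field)"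
  by (rule SL2.inv_equality) (auto simp: mat_1_mat2 algebra_simps)

lemma minus_mat1_mult [simp]:
  "(- mat 1) ** A = - (A :: 'a::field^2^2)" "A ** (- mat 1) = - (A :: 'a::field^2^2)"
  by (cases A; simp add: mat_1_mat2)+

lemma minus_mult_minus [simp]: "(- A) ** (- B) = (A :: 'a::field^2^2) ** (B :: 'a^2^2)"
  by (cases A; cases B; simp)

lemma det_uminus2 [simp]: "det (- A) = det (A :: 'a::field^2^2)"
  by (cases A) simp

lemma normal_center_pm: "center_pm \<lhd> (SL2 :: ('a::field^2^2) monoid)"
proof -
  have inv: "inv\<^bsub>SL2\<^esub> (- mat 1) = (- mat 1 :: 'a^2^2)"
    by (rule SL2.inv_equality) auto
  have "subgroup center_pm (SL2 :: ('a^2^2) monoid)"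
    using inv SL2.inv_one by (intro SL2.subgroupI) (auto simp: center_pm_def)
  moreover have "A \<otimes>\<^bsub>SL2\<^esub> h \<otimes>\<^bsub>SL2\<^esub> inv\<^bsub>SL2\<^esub> A \<in> center_pm"
    if "A \<in> carrier SL2" "h \<in> center_pm" for A h :: "'a^2^2"
  proof -
    have [simp]: "A ** inv\<^bsub>SL2\<^esub> A = mat 1"
      using SL2.r_inv[OF that(1)] by simp
    then show ?thesis
      using that(2) by (auto simp: center_pm_def uminus_mult_mat2)
  qed
  ultimately show ?thesis
    by (auto simp: SL2.normal_inv_iff)
qed

lemma group_hom_proj: "group_hom SL2 PSL2 (proj_PSL2 :: 'a::field^2^2 \<Rightarrow> _)"
proof -
  interpret normal "center_pm :: ('a^2^2) set" SL2
    by (rule normal_center_pm)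
  have "proj_PSL2 = (\<lambda>A :: 'a^2^2. center_pm #>\<^bsub>SL2\<^esub> A)"
    by (auto simp: proj_PSL2_def)
  then show ?thesis
    using r_coset_hom_Mod factorgroup_is_group
    by (auto simp: group_hom_def group_hom_axioms_def PSL2_def)
qed

lemma proj_PSL2_eq: "proj_PSL2 A = {A, - A}"
  by (auto simp: proj_PSL2_def r_coset_def center_pm_def)

lemma proj_PSL2_eq_iff: "proj_PSL2 A = proj_PSL2 B \<longleftrightarrow> A = B \<or> A = - B"
  by (auto simp: proj_PSL2_eq doubleton_eq_iff)

lemma one_PSL2: "\<one>\<^bsub>PSL2\<^esub> = proj_PSL2 (mat 1)"
  by (metis group_hom.hom_one[OF group_hom_proj] one_SL2)

lemma proj_PSL2_eq_one_iff: "proj_PSL2 A = \<one>\<^bsub>PSL2\<^esub> \<longleftrightarrow> A = mat 1 \<or> A = - mat 1"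
  by (simp add: one_PSL2 proj_PSL2_eq_iff)

lemma proj_PSL2_pow:
  "det A = 1 \<Longrightarrow> proj_PSL2 A [^]\<^bsub>PSL2\<^esub> (n::nat) = proj_PSL2 (A [^]\<^bsub>SL2\<^esub> n)"
  using group_hom.hom_nat_pow[OF group_hom_proj, of A n] by simp

section \<open>Trace two, unipotence and orders in \<open>PSL2\<close>\<close>

lemma tr2_eq_2_cases:
  fixes A :: "'a::field^2^2"
  assumes "det A = 1" "tr2 A = 2"
  obtains x y z where "A = mat2 (1 + x) y z (1 - x)" "y * z = - (x * x)"
proof -
  obtain a b c d where [simp]: "A = mat2 a b c d" by (cases A)
  have d: "d = 2 - a" using assms(2) by (simp add: algebra_simps)
  have det: "a * d - b * c = 1" using assms(1) by simp
  show thesis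
  proof (rule that[of "a - 1" b c])
    show "A = mat2 (1 + (a - 1)) b c (1 - (a - 1))" using d by simp
    show "b * c = - ((a - 1) * (a - 1))"
      using det unfolding d by (simp add: algebra_simps)
  qed
qed

text \<open>\<open>A - mat 1\<close> has trace and determinant zero, so its square vanishes by
  Cayley-Hamilton.\<close>

lemma unipotent_matrix_tr2:
  assumes "det A = 1" "tr2 A = 2"
  shows "unipotent_matrix A"
proof -
  obtain x y z where A: "A = mat2 (1 + x) y z (1 - x)" and yz: "y * z = - (x * x)"
    using assms by (rule tr2_eq_2_cases)
  have "(\<lambda>B. B ** (A - mat 1)) ((\<lambda>B. B ** (A - mat 1)) (mat 1)) = 0"
    using yz by (simp add: A mat_1_mat2 zero_mat2 mult.commute[of z])
  then show ?thesis
    unfolding unipotent_matrix_def by (intro exI[of _ "Suc (Suc 0)"]) simp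
qed

text \<open>The hypothesis says that the trace-free matrix N with entries x, y, z, -x has
  determinant zero; then N has square zero and (1 + N)^n = 1 + nN.\<close>

lemma pow_unipotent:
  assumes "y * z = - (x * x)"
  shows "mat2 (1 + x) y z (1 - x) [^]\<^bsub>SL2\<^esub> (n::nat) =
    mat2 (1 + of_nat n * x) (of_nat n * y) (of_nat n * z) (1 - of_nat n * (x :: 'a::field))"
proof (induction n)
  case 0
  then show ?case by (simp add: mat_1_mat2)
next
  case (Suc n)
  have "(1 + m * x) * (1 + x) + m * y * z = 1 + (m + 1) * x"
    "m * z * y + (1 - m * x) * (1 - x) = 1 - (m + 1) * x"
    "(1 + m * x) * y + m * y * (1 - x) = (m + 1) * y"
    "m * z * (1 + x) + (1 - m * x) * z = (m + 1) * z" for m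
  proof -
    have *: "m * y * z = - (m * x * x)" "m * z * y = - (m * x * x)"
      using assms by (simp_all add: mult.assoc mult.commute[of z])
    show "(1 + m * x) * (1 + x) + m * y * z = 1 + (m + 1) * x"
      "m * z * y + (1 - m * x) * (1 - x) = 1 - (m + 1) * x"
      unfolding * by (simp_all add: algebra_simps)
    show "(1 + m * x) * y + m * y * (1 - x) = (m + 1) * y"
      "m * z * (1 + x) + (1 - m * x) * z = (m + 1) * z"
      by (simp_all add: algebra_simps)
  qed
  then show ?case
    using Suc by (simp add: add.commute[of 1])
qed

lemma two_neq_0_CHAR:
  assumes "CHAR('a::field) \<noteq> 2"
  shows "(2 :: 'a) \<noteq> 0"
proof
  assume "(2 :: 'a) = 0"
  then have "CHAR('a) dvd 2"
    by (metis of_nat_eq_0_iff_char_dvd of_nat_numeral)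
  then have "CHAR('a) = 1 \<or> CHAR('a) = 2"
    using two_is_prime_nat prime_nat_iff by blast
  then show False using assms CHAR_not_1 by simp
qed

text \<open>The conclusion \<open>CHAR('a) > 0\<close> says that in characteristic zero there is no such element.\<close>
lemma torsion_trace_pm2:
  fixes A :: "'a::field^2^2"
  assumes char: "CHAR('a) \<noteq> 2" and A: "det A = 1" "tr2 A = 2 \<or> tr2 A = -2"
    and tors: "torsion_PSL2 (proj_PSL2 A)" and nontriv: "proj_PSL2 A \<noteq> \<one>\<^bsub>PSL2\<^esub>"
  shows "unipotent_PSL2 (proj_PSL2 A)" "CHAR('a) > 0" "group.ord PSL2 (proj_PSL2 A) = CHAR('a)"
proof -
  have two: "(2 :: 'a) \<noteq> 0"
    using char by (rule two_neq_0_CHAR)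
  \<comment> \<open>A change of sign normalises the trace to 2 and keeps the image in
    \<open>PSL2\<close>.\<close>
  define B where "B = (if tr2 A = 2 then A else - A)"
  have B: "det B = 1" "tr2 B = 2" and pB: "proj_PSL2 B = proj_PSL2 A"
    using A by (auto simp: B_def proj_PSL2_eq_iff)
  show "unipotent_PSL2 (proj_PSL2 A)"
    unfolding unipotent_PSL2_def using B pB unipotent_matrix_tr2 by (intro bexI[of _ B]) auto
  obtain x y z where Beq: "B = mat2 (1 + x) y z (1 - x)" and yz: "y * z = - (x * x)"
    using B by (rule tr2_eq_2_cases)
  note pow = pow_unipotent[OF yz, folded Beq]
  have pow_iff: "proj_PSL2 B [^]\<^bsub>PSL2\<^esub> n = \<one>\<^bsub>PSL2\<^esub> \<longleftrightarrow> of_nat n = (0 :: 'a)" for n :: nat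
  proof
    assume "proj_PSL2 B [^]\<^bsub>PSL2\<^esub> n = \<one>\<^bsub>PSL2\<^esub>"
    then have "B [^]\<^bsub>SL2\<^esub> n = mat 1 \<or> B [^]\<^bsub>SL2\<^esub> n = - mat 1"
      using B by (simp add: proj_PSL2_pow proj_PSL2_eq_one_iff)
    \<comment> \<open>All powers of \<open>B\<close> have trace 2, which excludes
      \<open>- mat 1\<close>: its trace -2 differs from 2 outside characteristic 2.\<close>
    moreover have "tr2 (B [^]\<^bsub>SL2\<^esub> n) = 2"
      by (simp add: pow)
    moreover have "tr2 (- mat 1 :: 'a^2^2) \<noteq> 2"
    proof
      assume "tr2 (- mat 1 :: 'a^2^2) = 2"
      then have eq: "- 1 - 1 = (2 :: 'a)"
        by (simp add: mat_1_mat2)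
      have "2 + (1 + 1 :: 'a) = 0"
        by (simp only: eq[symmetric]) simp
      then have "(2 :: 'a) * 2 = 0"
        by simp
      then show False unfolding mult_eq_0_iff using two by simp
    qed
    ultimately have eq: "B [^]\<^bsub>SL2\<^esub> n = mat 1" by auto
    show "of_nat n = (0 :: 'a)"
    proof (rule ccontr)
      assume "of_nat n \<noteq> (0 :: 'a)"
      then have "B = mat 1"
        using eq by (simp add: pow) (simp add: Beq mat_1_mat2)
      then show False using nontriv pB one_PSL2 by metis
    qed
  next
    assume "of_nat n = (0 :: 'a)"
    then have "B [^]\<^bsub>SL2\<^esub> n = mat 1"
      by (simp add: pow mat_1_mat2)
    then show "proj_PSL2 B [^]\<^bsub>PSL2\<^esub> n = \<one>\<^bsub>PSL2\<^esub>"
      using B by (simp add: proj_PSL2_pow proj_PSL2_eq_one_iff)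
  qed
  obtain n :: nat where "n > 0" "of_nat n = (0 :: 'a)"
    using tors pow_iff unfolding torsion_PSL2_def pB[symmetric] by auto
  then show "CHAR('a) > 0"
    by (simp add: of_nat_eq_0_iff_char_dvd) (metis dvd_pos_nat)
  interpret group_hom SL2 PSL2 "proj_PSL2 :: 'a^2^2 \<Rightarrow> _" by (rule group_hom_proj)
  have "proj_PSL2 B \<in> carrier PSL2" using B hom_closed by simp
  \<comment> \<open>The order and the characteristic have the same multiples, so they are
    equal.\<close>
  then have "H.ord (proj_PSL2 B) dvd k \<longleftrightarrow> CHAR('a) dvd k" for k
    using pow_iff H.pow_eq_id by (simp add: of_nat_eq_0_iff_char_dvd)
  then show "group.ord PSL2 (proj_PSL2 A) = CHAR('a)"
    using pB by (metis dvd_antisym dvd_refl)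
qed

section \<open>Countable subfields and transcendental elements\<close>

text \<open>Closure under \<open>inverse\<close> can include 0 because
  \<open>inverse 0 = 0\<close>.\<close>

definition subfield_set :: "'a::field set \<Rightarrow> bool" where
  "subfield_set F \<longleftrightarrow> 0 \<in> F \<and> 1 \<in> F \<and>
     (\<forall>x\<in>F. \<forall>y\<in>F. x + y \<in> F \<and> x * y \<in> F) \<and> (\<forall>x\<in>F. - x \<in> F \<and> inverse x \<in> F)"

lemma subfield_setD:
  assumes "subfield_set F"
  shows "0 \<in> F" "1 \<in> F" "x \<in> F \<Longrightarrow> y \<in> F \<Longrightarrow> x + y \<in> F" "x \<in> F \<Longrightarrow> y \<in> F \<Longrightarrow> x * y \<in> F"
    "x \<in> F \<Longrightarrow> - x \<in> F" "x \<in> F \<Longrightarrow> inverse x \<in> F"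
    "x \<in> F \<Longrightarrow> y \<in> F \<Longrightarrow> x - y \<in> F" "x \<in> F \<Longrightarrow> y \<in> F \<Longrightarrow> x / y \<in> F"
  using assms unfolding subfield_set_def diff_conv_add_uminus divide_inverse by blast+

text \<open>Close up in countably many steps, each adding the results of single field operations;
  any two elements of the union appear at a common stage.\<close>

lemma countable_subfield_exists:
  fixes A :: "'a::field set"
  assumes "countable A"
  shows "\<exists>F. subfield_set F \<and> countable F \<and> A \<subseteq> F"
proof -
  let ?step = "\<lambda>B :: 'a set. B \<union> (\<lambda>(x, y). x + y) ` (B \<times> B) \<union> (\<lambda>(x, y). x * y) ` (B \<times> B)
    \<union> uminus ` B \<union> inverse ` B"
  define B where "B n = (?step ^^ n) (insert 0 (insert 1 A))" for n
  have B0: "B 0 = insert 0 (insert 1 A)" and B_Suc: "B (Suc n) = ?step (B n)" for n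
    by (simp_all add: B_def)
  have "countable (B n)" for n
    by (induction n) (use assms in \<open>auto simp: B0 B_Suc\<close>)
  moreover have mono: "B m \<subseteq> B n" if "m \<le> n" for m n
    using that by (rule lift_Suc_mono_le[of B, rotated]) (auto simp: B_Suc)
  have "subfield_set (\<Union>n. B n)"
    unfolding subfield_set_def
  proof (intro conjI ballI)
    show "0 \<in> (\<Union>n. B n)" "1 \<in> (\<Union>n. B n)" using B0 by auto
  next
    fix x y assume "x \<in> (\<Union>n. B n)" "y \<in> (\<Union>n. B n)"
    then obtain m n where "x \<in> B m" "y \<in> B n" by auto
    then have "x \<in> B (max m n)" "y \<in> B (max m n)" using mono[of m "max m n"] mono[of n "max m n"] by auto
    then have "x + y \<in> B (Suc (max m n))" "x * y \<in> B (Suc (max m n))"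
      unfolding B_Suc by auto
    then show "x + y \<in> (\<Union>n. B n)" "x * y \<in> (\<Union>n. B n)" by blast+
  next
    fix x assume "x \<in> (\<Union>n. B n)"
    then obtain n where "x \<in> B n" by auto
    then have "- x \<in> B (Suc n)" "inverse x \<in> B (Suc n)" unfolding B_Suc by auto
    then show "- x \<in> (\<Union>n. B n)" "inverse x \<in> (\<Union>n. B n)" by blast+
  qed
  moreover have "A \<subseteq> (\<Union>n. B n)" using B0 by auto
  ultimately show ?thesis by blast
qed

definition polys_over :: "'a::field set \<Rightarrow> 'a poly set" where
  "polys_over F = {p. \<forall>i. Polynomial.coeff p i \<in> F}"

definition transcendental_over :: "'a::field set \<Rightarrow> 'a \<Rightarrow> bool" where
  "transcendental_over F x \<longleftrightarrow> (\<forall>p\<in>polys_over F. poly p x = 0 \<longrightarrow> p = 0)"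

lemma transcendental_overD:
  "transcendental_over F x \<Longrightarrow> p \<in> polys_over F \<Longrightarrow> poly p x = 0 \<Longrightarrow> p = 0"
  by (auto simp: transcendental_over_def)

lemma countable_polys_over:
  assumes "countable F"
  shows "countable (polys_over F)"
proof -
  have "polys_over F \<subseteq> Poly ` lists F"
  proof
    fix p assume "p \<in> polys_over F"
    then have "coeffs p \<in> lists F"
      by (auto simp: polys_over_def coeffs_def)
    then show "p \<in> Poly ` lists F"
      by (metis Poly_coeffs image_eqI)
  qed
  then show ?thesis
    by (rule countable_subset) (intro countable_image countable_lists assms)
qed

text \<open>Countably many nonzero polynomials, each with finitely many roots, cannot exhaust an
  uncountable field.\<close>

lemma transcendental_exists:
  fixes F :: "'a::field set"
  assumes "uncountable (UNIV :: 'a set)" "countable F"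
  shows "\<exists>x. transcendental_over F x"
proof -
  let ?A = "\<Union>p\<in>polys_over F - {0}. {x. poly p x = 0}"
  have "countable ?A"
    using countable_polys_over[OF assms(2)] poly_roots_finite
    by (intro countable_UN) (auto intro: countable_finite)
  then obtain x where "x \<notin> ?A"
    using assms(1) by (metis UNIV_eq_I)
  then show ?thesis
    by (auto simp: transcendental_over_def)
qed

context
  fixes F :: "'a::field set"
  assumes F: "subfield_set F"
begin

lemma polys_over_add: "p \<in> polys_over F \<Longrightarrow> q \<in> polys_over F \<Longrightarrow> p + q \<in> polys_over F"
  and polys_over_diff: "p \<in> polys_over F \<Longrightarrow> q \<in> polys_over F \<Longrightarrow> p - q \<in> polys_over F"
  and polys_over_uminus: "p \<in> polys_over F \<Longrightarrow> - p \<in> polys_over F"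
  and polys_over_0: "0 \<in> polys_over F"
  and polys_over_monom: "c \<in> F \<Longrightarrow> Polynomial.monom c n \<in> polys_over F"
  using subfield_setD[OF F] by (auto simp: polys_over_def)

lemma polys_over_pCons_iff: "pCons c p \<in> polys_over F \<longleftrightarrow> c \<in> F \<and> p \<in> polys_over F"
  by (force simp: polys_over_def coeff_pCons split: nat.splits)

lemma polys_over_mult:
  assumes "p \<in> polys_over F" "q \<in> polys_over F"
  shows "p * q \<in> polys_over F"
proof -
  have "sum f A \<in> F" if "\<And>i. i \<in> A \<Longrightarrow> f i \<in> F" for f and A :: "nat set"
    using that subfield_setD[OF F] by (induction A rule: infinite_finite_induct) auto
  then show ?thesis
    using assms subfield_setD(4)[OF F] by (auto simp: polys_over_def coeff_mult)
qed

lemmas polys_over_intros =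
  polys_over_add polys_over_diff polys_over_uminus polys_over_0 polys_over_monom polys_over_mult
  subfield_setD[OF F]

end

text \<open>Each sequence of digits 0 and 1 gives a power series in \<open>u\<close> that converges
  by completeness. Distinct sequences have distinct sums, and by Cantor's diagonal argument there
  are uncountably many sequences.\<close>

lemma local_field_uncountable:
  fixes v :: "'a::field \<Rightarrow> real"
  assumes "nonarch_local_field v"
  shows "uncountable (UNIV :: 'a set)"
proof -
  have v: "nonarch_abs v" "discrete_nontrivial_abs v" "abs_complete v"
    using assms by (auto simp: nonarch_local_field_def)
  have v_ge: "0 \<le> v x" and v_0: "v x = 0 \<longleftrightarrow> x = 0" and v_mult: "v (x * y) = v x * v y"
    and v_add: "v (x + y) \<le> max (v x) (v y)" for x y
    using v(1) by (auto simp: nonarch_abs_def)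
  obtain u where u: "0 < v u" "v u < 1"
    using v(2) by (auto simp: discrete_nontrivial_abs_def)
  have "v 1 = 1"
    using v_mult[of 1 1] v_0[of 1] by simp
  have v_pow: "v (u ^ n) = v u ^ n" for n
    by (induction n) (simp_all add: v_mult \<open>v 1 = 1\<close>)
  have "v (- 1) = 1"
  proof -
    have "v (- 1) ^ 2 = 1" using v_mult[of "- 1" "- 1"] \<open>v 1 = 1\<close> by (simp add: power2_eq_square)
    then show ?thesis using v_ge[of "- 1"] by (simp add: power2_eq_1_iff)
  qed
  then have v_minus: "v (- x) = v x" for x
    using v_mult[of "- 1" x] by simp
  have v_diff: "v (x - y) \<le> max (v x) (v y)" for x y
    using v_add[of x "- y"] v_minus by simp
  define S where "S b n = (\<Sum>i<n. if b i then u ^ i else 0)" for b :: "nat \<Rightarrow> bool" and n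
  have tail: "v (S b n - S b m) \<le> v u ^ m" if "m \<le> n" for b m n
    using that
  proof (induction n rule: dec_induct)
    case base
    then show ?case using u v_0[of 0] by simp
  next
    case (step n)
    have "v (S b (Suc n) - S b m) \<le> max (v (S b n - S b m)) (v (if b n then u ^ n else 0))"
      using v_add[of "S b n - S b m" "if b n then u ^ n else 0"] by (simp add: S_def algebra_simps)
    moreover have "v (if b n then u ^ n else 0) \<le> v u ^ m"
      using u step v_0[of 0] by (auto simp: v_pow intro: power_decreasing)
    ultimately show ?case using step.IH by linarith
  qed
  have "\<exists>l. \<forall>e>0. \<exists>k. \<forall>j\<ge>k. v (S b j - l) < e" for b
  proof -
    have "\<exists>k. \<forall>i\<ge>k. \<forall>j\<ge>k. v (S b i - S b j) < e" if "e > 0" for e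
    proof -
      obtain k where k: "v u ^ k < e"
        using real_arch_pow_inv \<open>e > 0\<close> u(2) by blast
      have "v (S b i - S b j) < e" if "i \<ge> k" "j \<ge> k" for i j
        using v_diff[of "S b i - S b k" "S b j - S b k"] tail[OF that(1), of b] tail[OF that(2), of b] k
        by simp
      then show ?thesis by blast
    qed
    then show ?thesis using v(3) unfolding abs_complete_def by blast
  qed
  then obtain L where L: "\<And>b e. e > 0 \<Longrightarrow> \<exists>k. \<forall>j\<ge>k. v (S b j - L b) < e"
    by metis
  have L_tail: "v (L b - S b m) \<le> v u ^ m" for b m
  proof -
    have "v u ^ m > 0" using u by simp
    then obtain k where k: "\<forall>j\<ge>k. v (S b j - L b) < v u ^ m" using L by blast
    have "v (S b (max k m) - L b) < v u ^ m" using k by simp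
    then show ?thesis
      using v_diff[of "S b (max k m) - S b m" "S b (max k m) - L b"] tail[of m "max k m" b]
      by simp
  qed
  have "inj L"
  proof (rule injI, rule ccontr)
    fix b c assume eq: "L b = L c" and "b \<noteq> c"
    then have ex: "\<exists>i. b i \<noteq> c i" by auto
    \<comment> \<open>At the first differing digit the partial sums part by plus or minus
      \<open>u ^ m\<close>, while both remainders have absolute value at most
      \<open>v u ^ Suc m\<close>, too small to compensate.\<close>
    define m where "m = (LEAST i. b i \<noteq> c i)"
    have m: "b m \<noteq> c m" unfolding m_def by (rule LeastI_ex[OF ex])
    have "\<And>i. i < m \<Longrightarrow> b i = c i" using not_less_Least unfolding m_def by blast
    then have "S b m = S c m" by (simp add: S_def)
    then have "v (S b (Suc m) - S c (Suc m)) = v u ^ m"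
      using m by (auto simp: S_def v_pow v_minus)
    moreover have "v (S b (Suc m) - S c (Suc m)) \<le> v u ^ Suc m"
      using v_diff[of "L c - S c (Suc m)" "L b - S b (Suc m)"] L_tail[of b "Suc m"] L_tail[of c "Suc m"] eq
      by simp
    moreover have "v u ^ Suc m < v u ^ m" using u by simp
    ultimately show False by simp
  qed
  moreover have "uncountable (UNIV :: (nat \<Rightarrow> bool) set)"
  proof
    assume "countable (UNIV :: (nat \<Rightarrow> bool) set)"
    then obtain f :: "nat \<Rightarrow> nat \<Rightarrow> bool" where "range f = UNIV"
      by (metis UNIV_not_empty uncountable_def)
    then obtain n where "f n = (\<lambda>i. \<not> f i i)" by (metis UNIV_I imageE)
    then show False by metis
  qed
  ultimately show ?thesis
    by (metis countable_image_inj_on countable_subset subset_UNIV)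
qed

section \<open>Conjugation\<close>

definition conj2 :: "'a::field^2^2 \<Rightarrow> 'a^2^2 \<Rightarrow> 'a^2^2 \<Rightarrow> 'a^2^2" where
  "conj2 P P' A = P ** A ** P'"

lemma conj2_mult:
  assumes "P' ** P = mat 1"
  shows "conj2 P P' (A ** B) = conj2 P P' A ** conj2 P P' B"
proof -
  have "conj2 P P' A ** conj2 P P' B = P ** A ** (P' ** P) ** B ** P'"
    unfolding conj2_def by (simp only: matrix_mul_assoc)
  then show ?thesis
    using assms by (simp add: conj2_def matrix_mul_assoc)
qed

lemma conj2_inverse:
  assumes "P' ** P = mat 1"
  shows "conj2 P' P (conj2 P P' A) = A"
proof -
  have "conj2 P' P (conj2 P P' A) = (P' ** P) ** A ** (P' ** P)"
    unfolding conj2_def by (simp only: matrix_mul_assoc)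
  then show ?thesis using assms by simp
qed

text \<open>\<open>P\<close> ranges over all invertible matrices, since the determinants of
  \<open>P\<close> and \<open>P'\<close> cancel; this covers conjugation by diag(z, 1).\<close>

lemma group_hom_conj2:
  assumes "P ** P' = mat 1"
  shows "group_hom SL2 SL2 (conj2 P (P' :: 'a::field^2^2))"
proof -
  have P'P: "P' ** P = mat 1"
    using assms matrix_left_right_inverse by blast
  have "det P * det P' = 1"
    by (metis assms det_I det_mul)
  then have "det (conj2 P P' A) = det A" for A
    by (simp add: conj2_def det_mul mult_ac)
  then show ?thesis
    using conj2_mult[OF P'P] by (auto simp: group_hom_def group_hom_axioms_def hom_def SL2.is_group)
qed

text \<open>Matrices whose image in \<open>PSL2\<close> is unipotent as soon as it is torsion.\<close>
definition torsion_imp_pm2 :: "'a::field^2^2 \<Rightarrow> bool" where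
  "torsion_imp_pm2 A \<longleftrightarrow>
     (\<forall>n>0. A [^]\<^bsub>SL2\<^esub> (n::nat) = mat 1 \<or> A [^]\<^bsub>SL2\<^esub> n = - mat 1 \<longrightarrow> tr2 A = 2 \<or> tr2 A = - 2)"

lemma torsion_imp_pm2_conj2:
  assumes "torsion_imp_pm2 A" "det A = 1" "P ** P' = mat 1"
  shows "torsion_imp_pm2 (conj2 P P' A)"
proof -
  interpret group_hom SL2 SL2 "conj2 P P'"
    by (rule group_hom_conj2) fact
  have P'P: "P' ** P = mat 1"
    using assms(3) matrix_left_right_inverse by blast
  have pm: "conj2 P' P (mat 1) = mat 1" "conj2 P' P (- mat 1) = - mat 1"
    using P'P by (simp_all add: conj2_def uminus_mult_mat2)
  have "tr2 (conj2 P P' A) = tr2 A"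
    unfolding conj2_def using tr2_mult_commute[of "P ** A" P'] P'P by (simp add: matrix_mul_assoc)
  moreover have "A [^]\<^bsub>SL2\<^esub> n = B" if "conj2 P P' A [^]\<^bsub>SL2\<^esub> n = B" "B = mat 1 \<or> B = - mat 1" for n :: nat and B
  proof -
    have "conj2 P P' (A [^]\<^bsub>SL2\<^esub> n) = B"
      using hom_nat_pow[of A n] that assms(2) by simp
    then show ?thesis
      using conj2_inverse[OF P'P, of "A [^]\<^bsub>SL2\<^esub> n"] pm that(2) by auto
  qed
  ultimately show ?thesis
    using assms(1) unfolding torsion_imp_pm2_def by metis
qed

section \<open>Traces of powers\<close>

text \<open>Rescaled Chebyshev polynomials of the first kind evaluated at \<open>r\<close>. By
  Cayley-Hamilton the traces of the powers of a determinant-one matrix with trace \<open>r\<close>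
  obey this recursion.\<close>

fun trace_poly :: "'a::field poly \<Rightarrow> nat \<Rightarrow> 'a poly" where
  "trace_poly r 0 = [:2:]"
| "trace_poly r (Suc 0) = r"
| "trace_poly r (Suc (Suc n)) = r * trace_poly r (Suc n) - trace_poly r n"

lemma poly_trace_poly:
  fixes A :: "'a::field^2^2"
  assumes "det A = 1" "tr2 A = poly r x"
  shows "poly (trace_poly r n) x = tr2 (A [^]\<^bsub>SL2\<^esub> n)"
proof -
  have *: "tr2 (B ** A ** A) = tr2 A * tr2 (B ** A) - tr2 B" for B
  proof -
    obtain a b c d where A: "A = mat2 a b c d" by (cases A)
    obtain a' b' c' d' where B: "B = mat2 a' b' c' d'" by (cases B)
    have "a * d - b * c = 1" using assms(1) by (simp add: A)
    then have "tr2 B = (a' + d') * (a * d - b * c)" by (simp add: B)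
    then show ?thesis by (simp add: A B algebra_simps)
  qed
  have "tr2 (mat 1 :: 'a^2^2) = 2" by (simp add: mat_1_mat2)
  with assms(2) show ?thesis
    by (induction r n rule: trace_poly.induct) (auto simp: *)
qed

text \<open>In the recursion the product has larger degree than the subtracted term, so leading
  terms never cancel.\<close>

lemma degree_trace_poly:
  assumes "Polynomial.degree r > 0"
  shows "Polynomial.degree (trace_poly r n) = n * Polynomial.degree r"
  using assms
proof (induction r n rule: trace_poly.induct)
  case (3 r n)
  then have "trace_poly r (Suc n) \<noteq> 0" "r \<noteq> 0" by auto
  then have deg: "Polynomial.degree (r * trace_poly r (Suc n)) = Suc (Suc n) * Polynomial.degree r"
    using 3 by (simp add: Polynomial.degree_mult_eq)
  moreover have "Polynomial.degree (- trace_poly r n) < Suc (Suc n) * Polynomial.degree r"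
    using 3 by simp
  ultimately show ?case
    using degree_add_eq_left[of "- trace_poly r n" "r * trace_poly r (Suc n)"] by simp
qed simp_all

section \<open>The parameter $s = x + x^{-1} - 2$\<close>

text \<open>With this s the determinant-one matrix with rows (1 + s, 1) and (s, 1) has trace
  \<open>x + 1 / x\<close>, hence eigenvalues \<open>x\<close> and \<open>1 / x\<close>.\<close>

definition spar :: "'a::field \<Rightarrow> 'a" where
  "spar x = x + 1 / x - 2"

text \<open>Reversing the coefficients turns a relation for \<open>1 / x\<close> into one for
  \<open>x\<close>.\<close>

lemma transcendental_over_inverse:
  assumes "transcendental_over F x"
  shows "transcendental_over F (1 / x)"
  unfolding transcendental_over_def
proof (intro ballI impI)
  fix p assume p: "p \<in> polys_over F" "poly p (1 / x) = 0"
  show "p = 0"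
  \<comment> \<open>For \<open>x = 0\<close> the default value \<open>1 / 0 = 0\<close> makes the
    claim the assumption itself.\<close>
  proof (cases "x = 0")
    case True
    then show ?thesis using p transcendental_overD[OF assms p(1)] by simp
  next
    case False
    have "Polynomial.coeff (reflect_poly p) i \<in> F" for i
    proof (cases "p = 0")
      case True
      then show ?thesis using p by (simp add: polys_over_def)
    next
      case nz: False
      \<comment> \<open>Here \<open>F\<close> is an arbitrary set; it contains 0 as a coefficient of
        \<open>p\<close> beyond the degree.\<close>
      have "0 \<in> F"
        using p(1) coeff_eq_0[of p "Suc (Polynomial.degree p)"] unfolding polys_over_def
        by (metis (mono_tags) lessI mem_Collect_eq)
      then show ?thesis using p by (simp add: polys_over_def coeff_reflect_poly)
    qed
    then have "reflect_poly p \<in> polys_over F" by (simp add: polys_over_def)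
    moreover have "poly (reflect_poly p) x = 0"
      using p(2) False by (simp add: poly_reflect_poly_nz inverse_eq_divide)
    ultimately show "p = 0"
      using transcendental_overD[OF assms] by fastforce
  qed
qed

context
  fixes F :: "'a::field set"
  assumes F: "subfield_set F"
begin

lemma transcendental_over_uminus:
  assumes "transcendental_over F x"
  shows "transcendental_over F (- x)"
  unfolding transcendental_over_def
proof (intro ballI impI)
  fix p assume p: "p \<in> polys_over F" "poly p (- x) = 0"
  have "(- 1) ^ i \<in> F" for i
    by (induction i) (use subfield_setD[OF F] in auto)
  then have "pcompose p [:0, - 1:] \<in> polys_over F"
    using p subfield_setD(4)[OF F] by (simp add: polys_over_def coeff_pcompose_linear)
  then have "pcompose p [:0, - 1:] = 0"
    using p by (intro transcendental_overD[OF assms]) (simp_all add: poly_pcompose)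
  then show "p = 0" by (simp add: pcompose_eq_0_iff)
qed

lemma transcendental_over_neq:
  assumes "transcendental_over F x"
  shows "x \<noteq> 0" "x * x \<noteq> 1"
proof -
  have "poly [:0, 1:] x \<noteq> 0" "poly [:-1, 0, 1:] x \<noteq> 0"
    using transcendental_overD[OF assms, of "[:0, 1:]"] transcendental_overD[OF assms, of "[:-1, 0, 1:]"]
    by (auto simp: polys_over_pCons_iff[OF F] polys_over_intros[OF F])
  then show "x \<noteq> 0" "x * x \<noteq> 1" by auto
qed

text \<open>Since \<open>x * spar x = (x - 1)^2\<close>, multiplying by a power of \<open>x\<close>
  clears denominators. The constant term becomes the leading coefficient of \<open>p\<close>, so a
  nonzero \<open>p\<close> yields a nonzero \<open>P\<close>.\<close>

lemma poly_spar_clear_denominators: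
  assumes "p \<in> polys_over F"
  shows "\<exists>P\<in>polys_over F. poly P 0 = Polynomial.coeff p (Polynomial.degree p) \<and>
    (\<forall>x. x \<noteq> 0 \<longrightarrow> poly P x = x ^ Polynomial.degree p * poly p (spar x))"
  using assms
proof (induction p)
  case 0
  then show ?case by (intro bexI[of _ 0]) auto
next
  case (pCons c p)
  note F_intros = polys_over_intros[OF F] polys_over_pCons_iff[OF F]
  have c: "c \<in> F" and p: "p \<in> polys_over F" using pCons.prems by (auto simp: F_intros)
  show ?case
  proof (cases "p = 0")
    case True
    then show ?thesis using c by (intro bexI[of _ "[:c:]"]) (auto simp: F_intros)
  next
    case False
    obtain P where P: "P \<in> polys_over F" "poly P 0 = Polynomial.coeff p (Polynomial.degree p)"
      "\<And>x. x \<noteq> 0 \<Longrightarrow> poly P x = x ^ Polynomial.degree p * poly p (spar x)"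
      using pCons.IH p by auto
    \<comment> \<open>This is \<open>x\<close> to the power \<open>Suc (degree p)\<close> times
      \<open>c + spar x * p(spar x)\<close>, with \<open>x * spar x\<close> rewritten as
      \<open>(x - 1)^2\<close>.\<close>
    let ?P = "Polynomial.monom c (Suc (Polynomial.degree p)) + [:-1, 1:] * [:-1, 1:] * P"
    show ?thesis
    proof (rule bexI[of _ ?P], intro conjI allI impI)
      show "?P \<in> polys_over F"
        by (intro F_intros c P(1) | simp add: F_intros)+
      show "poly ?P 0 = Polynomial.coeff (pCons c p) (Polynomial.degree (pCons c p))"
        using False P(2) by (simp add: poly_monom)
      fix x :: 'a assume x: "x \<noteq> 0"
      have "(x - 1) * (x - 1) = x * spar x"
        using x by (simp add: spar_def field_simps)
      moreover have "poly ?P x = c * (x * x ^ Polynomial.degree p)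
          + ((x - 1) * (x - 1)) * (x ^ Polynomial.degree p * poly p (spar x))"
        using P(3)[OF x] by (simp add: poly_monom algebra_simps)
      ultimately show "poly ?P x = x ^ Polynomial.degree (pCons c p) * poly (pCons c p) (spar x)"
        using False by (simp add: algebra_simps)
    qed
  qed
qed

lemma poly_spar_clear_denominators_le:
  assumes "p \<in> polys_over F" "Polynomial.degree p \<le> N"
  obtains P where "P \<in> polys_over F" "\<And>x. x \<noteq> 0 \<Longrightarrow> poly P x = x ^ N * poly p (spar x)"
proof -
  obtain P where P: "P \<in> polys_over F"
    "\<And>x. x \<noteq> 0 \<Longrightarrow> poly P x = x ^ Polynomial.degree p * poly p (spar x)"
    using poly_spar_clear_denominators[OF assms(1)] by blast
  let ?P = "Polynomial.monom 1 (N - Polynomial.degree p) * P"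
  have "?P \<in> polys_over F"
    by (intro polys_over_intros[OF F] P)
  moreover have "poly ?P x = x ^ N * poly p (spar x)" if "x \<noteq> 0" for x
    using P(2)[OF that] assms(2) by (simp add: poly_monom flip: mult.assoc power_add)
  ultimately show thesis by (rule that)
qed

lemma transcendental_over_spar:
  assumes "transcendental_over F x"
  shows "transcendental_over F (spar x)"
  unfolding transcendental_over_def
proof (intro ballI impI)
  fix p assume p: "p \<in> polys_over F" "poly p (spar x) = 0"
  obtain P where P: "P \<in> polys_over F" "poly P 0 = Polynomial.coeff p (Polynomial.degree p)"
    "\<And>x. x \<noteq> 0 \<Longrightarrow> poly P x = x ^ Polynomial.degree p * poly p (spar x)"
    using poly_spar_clear_denominators[OF p(1)] by blast
  have "poly P x = 0"
    using P(3)[of x] p(2) transcendental_over_neq[OF assms] by simp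
  then have "P = 0" using transcendental_overD[OF assms P(1)] by simp
  then show "p = 0" using P(2) by simp
qed

text \<open>The vanishing persists under the substitution of \<open>1 / x\<close> for \<open>x\<close>, which fixes \<open>spar x\<close>.\<close>
lemma spar_independent:
  assumes x: "transcendental_over F x" and p: "p \<in> polys_over F" and q: "q \<in> polys_over F"
    and zero: "poly p (spar x) + poly q (spar x) * (1 - 1 / x) = 0"
  shows "poly p (spar x) = 0" "poly q (spar x) = 0"
proof -
  note x_neq = transcendental_over_neq[OF x]
  define N where "N = max (Polynomial.degree p) (Polynomial.degree q)"
  obtain P where P: "P \<in> polys_over F" "\<And>x. x \<noteq> 0 \<Longrightarrow> poly P x = x ^ N * poly p (spar x)"
    using poly_spar_clear_denominators_le[OF p, of N] by (auto simp: N_def)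
  obtain Q where Q: "Q \<in> polys_over F" "\<And>x. x \<noteq> 0 \<Longrightarrow> poly Q x = x ^ N * poly q (spar x)"
    using poly_spar_clear_denominators_le[OF q, of N] by (auto simp: N_def)
  \<comment> \<open>Clears denominators in the relation; the factors \<open>x\<close> and
    \<open>x - 1\<close> are \<open>x\<close> times 1 and times \<open>1 - 1 / x\<close>.\<close>
  let ?R = "[:0, 1:] * P + [:-1, 1:] * Q"
  have R: "poly ?R y = y ^ Suc N * (poly p (spar y) + poly q (spar y) * (1 - 1 / y))" if "y \<noteq> 0" for y
    using P(2)[OF that] Q(2)[OF that] that by (simp add: field_simps)
  have "?R \<in> polys_over F"
    by (intro polys_over_intros[OF F] P Q) (simp_all add: polys_over_pCons_iff[OF F] polys_over_intros[OF F])
  then have "?R = 0"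
    using R[OF x_neq(1)] zero by (intro transcendental_overD[OF x]) simp_all
  then have "poly ?R (1 / x) = 0" by (metis poly_0)
  moreover have "spar (1 / x) = spar x" using x_neq by (simp add: spar_def)
  ultimately have "poly p (spar x) + poly q (spar x) * (1 - x) = 0"
    using R[of "1 / x"] x_neq by simp
  \<comment> \<open>Subtracting the relation for \<open>1 / x\<close> from the one for
    \<open>x\<close> eliminates \<open>p\<close>.\<close>
  moreover have "poly q (spar x) * (x - 1 / x) =
      (poly p (spar x) + poly q (spar x) * (1 - 1 / x)) - (poly p (spar x) + poly q (spar x) * (1 - x))"
    by (simp add: algebra_simps)
  ultimately have "poly q (spar x) * (x - 1 / x) = 0"
    using zero by simp
  moreover have "x - 1 / x \<noteq> 0" using x_neq by (simp add: field_simps)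
  ultimately show q0: "poly q (spar x) = 0" by simp
  then show "poly p (spar x) = 0" using zero by simp
qed

end

text \<open>As long as n > 0, one of the two factors has constant term zero, so the variable can be
  cancelled from it.\<close>

lemma mult_eq_monom_imp_monom:
  fixes p q :: "'a::field poly"
  assumes "p * q = Polynomial.monom 1 n"
  shows "\<exists>c j. p = Polynomial.monom c j"
  using assms
proof (induction n arbitrary: p q)
  case 0
  then have "p dvd 1" by (metis dvd_triv_left monom_eq_1)
  then obtain c where "p = [:c:]" by (metis is_unit_polyE)
  then show ?case by (metis monom_0)
next
  case (Suc n)
  have "poly p 0 * poly q 0 = 0"
    using arg_cong[OF Suc.prems, of "\<lambda>p. poly p 0"] by (simp add: poly_monom)
  then consider "poly p 0 = 0" | "poly q 0 = 0" by auto
  then show ?case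
  proof cases
    case 1
    then obtain p' where p': "p = pCons 0 p'" by (cases p) auto
    then have "p' * q = Polynomial.monom 1 n" using Suc.prems by (simp add: monom_Suc)
    then show ?thesis using Suc.IH p' by (metis monom_Suc)
  next
    case 2
    then obtain q' where "q = pCons 0 q'" by (cases q) auto
    then have "p * q' = Polynomial.monom 1 n" using Suc.prems by (simp add: monom_Suc)
    then show ?thesis by (rule Suc.IH)
  qed
qed

text \<open>The units of \<open>F[x, 1/x]\<close> are the monomials; the constant is found by evaluating at \<open>x = 1\<close>,
  where \<open>spar x = 0\<close>.\<close>
lemma spar_unit:
  fixes x :: "'a::field"
  assumes F: "subfield_set F" and x: "transcendental_over F x"
    and p: "p \<in> polys_over F" and q: "q \<in> polys_over F"
    and unit: "(poly p (spar x) + poly q (spar x) * (1 - 1 / x)) *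
               (poly p (spar x) + poly q (spar x) * (1 - x)) = 1"
  shows "\<exists>i j. poly p (spar x) + poly q (spar x) * (1 - 1 / x) = poly p 0 * x ^ i / x ^ j"
proof -
  note x_neq = transcendental_over_neq[OF F x]
  define N where "N = max (Polynomial.degree p) (Polynomial.degree q)"
  obtain P where P: "P \<in> polys_over F" "\<And>x. x \<noteq> 0 \<Longrightarrow> poly P x = x ^ N * poly p (spar x)"
    using poly_spar_clear_denominators_le[OF F p, of N] by (auto simp: N_def)
  obtain Q where Q: "Q \<in> polys_over F" "\<And>x. x \<noteq> 0 \<Longrightarrow> poly Q x = x ^ N * poly q (spar x)"
    using poly_spar_clear_denominators_le[OF F q, of N] by (auto simp: N_def)
  \<comment> \<open>\<open>R\<close> and \<open>R'\<close> are the two factors of the unit equation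
    without denominators; \<open>R\<close> takes one more power of \<open>x\<close> because of
    \<open>1 / x\<close>.\<close>
  define R where "R = [:0, 1:] * P + [:-1, 1:] * Q"
  define R' where "R' = P + [:1, -1:] * Q"
  note F_intros = polys_over_intros[OF F] polys_over_pCons_iff[OF F]
  have R: "poly R y = y ^ Suc N * (poly p (spar y) + poly q (spar y) * (1 - 1 / y))" if "y \<noteq> 0" for y
    using P(2)[OF that] Q(2)[OF that] that by (simp add: R_def field_simps)
  have R': "poly R' y = y ^ N * (poly p (spar y) + poly q (spar y) * (1 - y))" if "y \<noteq> 0" for y
    using P(2)[OF that] Q(2)[OF that] that by (simp add: R'_def field_simps)
  have "R \<in> polys_over F" "R' \<in> polys_over F"
    unfolding R_def R'_def
    by (intro polys_over_intros[OF F] P Q; simp add: F_intros)+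
  then have "R * R' - Polynomial.monom 1 (Suc N + N) \<in> polys_over F"
    by (intro polys_over_intros[OF F])
  moreover have "poly (R * R' - Polynomial.monom 1 (Suc N + N)) x = 0"
  proof -
    have "poly (R * R') x = x ^ Suc N * x ^ N * ((poly p (spar x) + poly q (spar x) * (1 - 1 / x)) *
               (poly p (spar x) + poly q (spar x) * (1 - x)))"
      unfolding poly_mult R[OF x_neq(1)] R'[OF x_neq(1)] by (simp only: mult_ac)
    also have "\<dots> = x ^ (Suc N + N)"
      unfolding unit by (simp add: power_add)
    finally show ?thesis by (simp add: poly_monom)
  qed
  ultimately have "R * R' = Polynomial.monom 1 (Suc N + N)"
    using transcendental_overD[OF x] by fastforce
  then obtain c i where c: "R = Polynomial.monom c i"
    using mult_eq_monom_imp_monom by blast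
  moreover have "poly R 1 = poly p 0"
    using R[of 1] by (simp add: spar_def)
  ultimately have "c = poly p 0" by (simp add: poly_monom)
  then have "poly p 0 * x ^ i = x ^ Suc N * (poly p (spar x) + poly q (spar x) * (1 - 1 / x))"
    using R[OF x_neq(1)] c by (simp add: poly_monom)
  then show ?thesis using x_neq by (intro exI[of _ i] exI[of _ "Suc N"]) simp
qed

section \<open>The vertex groups\<close>

text \<open>Matrices over \<open>F[s]\<close> of determinant one that reduce modulo \<open>s\<close> to plus or minus an upper
  unipotent matrix.\<close>
definition Gam :: "'a::field set \<Rightarrow> 'a \<Rightarrow> ('a^2^2) set" where
  "Gam F s = {mat2 (poly p s) (poly q s) (poly r s) (poly t s) | p q r t.
     {p, q, r, t} \<subseteq> polys_over F \<and> poly r 0 = 0 \<and> poly t 0 = poly p 0 \<and> poly p 0 \<in> {1, - 1} \<and>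
     poly p s * poly t s - poly q s * poly r s = 1}"

lemma Gam_I:
  assumes "p \<in> polys_over F" "q \<in> polys_over F" "r \<in> polys_over F" "t \<in> polys_over F"
    "poly r 0 = 0" "poly t 0 = poly p 0" "poly p 0 \<in> {1, - 1}"
    "poly p s * poly t s - poly q s * poly r s = 1"
    "A = mat2 (poly p s) (poly q s) (poly r s) (poly t s)"
  shows "A \<in> Gam F s"
  using assms unfolding Gam_def by blast

lemma Gam_E:
  assumes "A \<in> Gam F s"
  obtains p q r t where "p \<in> polys_over F" "q \<in> polys_over F" "r \<in> polys_over F" "t \<in> polys_over F"
    "poly r 0 = 0" "poly t 0 = poly p 0" "poly p 0 \<in> {1, - 1}"
    "poly p s * poly t s - poly q s * poly r s = 1"
    "A = mat2 (poly p s) (poly q s) (poly r s) (poly t s)"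
  using assms unfolding Gam_def by blast

lemma det_Gam: "A \<in> Gam F s \<Longrightarrow> det A = 1"
  by (auto simp: Gam_def)

lemma subgroup_Gam:
  assumes F: "subfield_set F"
  shows "subgroup (Gam F s) SL2"
proof (rule SL2.subgroupI)
  show "Gam F s \<subseteq> carrier SL2" using det_Gam by auto
next
  have "mat 1 \<in> Gam F s"
    by (rule Gam_I[of "[:1:]" _ "[:0:]" "[:0:]" "[:1:]"])
      (auto simp: polys_over_pCons_iff[OF F] polys_over_intros[OF F] mat_1_mat2)
  then show "Gam F s \<noteq> {}" by blast
next
  fix A assume "A \<in> Gam F s"
  then obtain p q r t where A: "p \<in> polys_over F" "q \<in> polys_over F" "r \<in> polys_over F" "t \<in> polys_over F"
    "poly r 0 = 0" "poly t 0 = poly p 0" "poly p 0 \<in> {1, - 1}"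
    "poly p s * poly t s - poly q s * poly r s = 1"
    "A = mat2 (poly p s) (poly q s) (poly r s) (poly t s)"
    by (rule Gam_E)
  show "inv\<^bsub>SL2\<^esub> A \<in> Gam F s"
    by (rule Gam_I[of t _ "- q" "- r" p])
      (use A in \<open>auto simp: inv_SL2_mat2 polys_over_intros[OF F] mult.commute\<close>)
next
  fix A B assume "A \<in> Gam F s" "B \<in> Gam F s"
  then obtain p q r t p' q' r' t'
    where A: "p \<in> polys_over F" "q \<in> polys_over F" "r \<in> polys_over F" "t \<in> polys_over F"
      "poly r 0 = 0" "poly t 0 = poly p 0" "poly p 0 \<in> {1, - 1}"
      "poly p s * poly t s - poly q s * poly r s = 1"
      "A = mat2 (poly p s) (poly q s) (poly r s) (poly t s)"
      and B: "p' \<in> polys_over F" "q' \<in> polys_over F" "r' \<in> polys_over F" "t' \<in> polys_over F"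
      "poly r' 0 = 0" "poly t' 0 = poly p' 0" "poly p' 0 \<in> {1, - 1}"
      "poly p' s * poly t' s - poly q' s * poly r' s = 1"
      "B = mat2 (poly p' s) (poly q' s) (poly r' s) (poly t' s)"
    by (elim Gam_E) blast
  have "det A = 1" "det B = 1" using A(8,9) B(8,9) by simp_all
  then have "det (A ** B) = 1" by (simp add: det_mul)
  note this[unfolded A(9) B(9) mat2_mult det_mat2]
  then show "A \<otimes>\<^bsub>SL2\<^esub> B \<in> Gam F s"
    by (intro Gam_I[of "p * p' + q * r'" _ "p * q' + q * t'" "r * p' + t * r'" "r * q' + t * t'"])
      (use A B in \<open>auto intro!: polys_over_intros[OF F]\<close>)
qed

text \<open>If the trace had positive degree in \<open>s\<close>, so would the trace of every
  positive power, and by transcendence it could not equal 2 or -2. A constant trace is read off at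
  0, where both diagonal polynomials take the same value 1 or -1.\<close>

lemma torsion_imp_pm2_Gam:
  assumes F: "subfield_set F" and s: "transcendental_over F s" and A: "A \<in> Gam F s"
  shows "torsion_imp_pm2 A"
  unfolding torsion_imp_pm2_def
proof (intro allI impI)
  fix n :: nat
  assume n: "n > 0" and pow: "A [^]\<^bsub>SL2\<^esub> n = mat 1 \<or> A [^]\<^bsub>SL2\<^esub> n = - mat 1"
  obtain p t where p: "p \<in> polys_over F" "t \<in> polys_over F" "poly t 0 = poly p 0" "poly p 0 \<in> {1, - 1}"
    and tr: "tr2 A = poly (p + t) s"
    using A by (auto elim!: Gam_E)
  have r: "p + t \<in> polys_over F" using p F by (simp add: polys_over_add)
  have two: "2 \<in> F" using subfield_setD(2,3)[OF F] by (metis one_add_one)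
  have "Polynomial.degree (p + t) = 0"
  proof (rule ccontr)
    assume deg: "Polynomial.degree (p + t) \<noteq> 0"
    have tp: "trace_poly (p + t) k \<in> polys_over F" for k
      using r by (induction "p + t" k rule: trace_poly.induct)
        (auto intro!: polys_over_intros[OF F] simp: polys_over_pCons_iff[OF F] two)
    obtain c where c: "c \<in> F" "poly (trace_poly (p + t) n) s = c"
      using poly_trace_poly[OF det_Gam[OF A] tr, of n] pow two subfield_setD(5)[OF F two]
      by (auto simp: mat_1_mat2)
    have "trace_poly (p + t) n - [:c:] = 0"
      using c by (intro transcendental_overD[OF s] polys_over_intros[OF F] tp)
        (auto simp: polys_over_pCons_iff[OF F] polys_over_0[OF F])
    then have "Polynomial.degree (trace_poly (p + t) n) = 0" by simp
    then show False using degree_trace_poly[of "p + t" n] deg n by simp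
  qed
  then obtain c where "p + t = [:c:]" by (metis degree_eq_zeroE)
  then have "poly (p + t) s = poly (p + t) 0" by simp
  then show "tr2 A = 2 \<or> tr2 A = - 2"
    using tr p by auto
qed

text \<open>The eigenvectors of \<open>mat2 (1 + s) 1 s 1 \<in> Gam F s\<close> for \<open>s = x + 1/x - 2\<close>.\<close>
definition eigen_mat :: "'a::field \<Rightarrow> 'a^2^2" where
  "eigen_mat x = mat2 1 1 (1 - 1 / x) (1 - x)"

text \<open>The adjugate of \<open>eigen_mat x\<close> divided by its determinant
  \<open>d\<close>.\<close>

definition eigen_mat_inv :: "'a::field \<Rightarrow> 'a^2^2" where
  "eigen_mat_inv x = (let d = 1 / x - x in mat2 ((1 - x) / d) (- 1 / d) ((1 / x - 1) / d) (1 / d))"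

text \<open>In this eigenbasis a vanishing off-diagonal entry means that an eigenline is
  fixed.\<close>

definition Hgrp :: "'a::field set \<Rightarrow> 'a \<Rightarrow> ('a^2^2) set" where
  "Hgrp F x = conj2 (eigen_mat_inv x) (eigen_mat x) ` Gam F (spar x)"

lemma conj_eigen_mat:
  "conj2 (eigen_mat_inv x) (eigen_mat x) (mat2 a b c d) =
    (let \<delta> = 1 / x - x; y = 1 - 1 / x; z = 1 - x in
     mat2 ((z * (a + b * y) - (c + d * y)) / \<delta>) ((z * (a + b * z) - (c + d * z)) / \<delta>)
          ((c + d * y - y * (a + b * y)) / \<delta>) ((c + d * z - y * (a + b * z)) / \<delta>))"
  by (simp add: conj2_def eigen_mat_def eigen_mat_inv_def Let_def)
    (simp add: divide_inverse algebra_simps)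

context
  fixes F :: "'a::field set" and x :: 'a
  assumes F: "subfield_set F" and x: "transcendental_over F x"
begin

lemma x_neq: "x \<noteq> 0" "x * x \<noteq> 1" "1 / x - x \<noteq> 0"
  using transcendental_over_neq[OF F x] by (auto simp: field_simps)

lemma eigen_mat_inverse: "eigen_mat_inv x ** eigen_mat x = mat 1" "eigen_mat x ** eigen_mat_inv x = mat 1"
proof -
  show "eigen_mat_inv x ** eigen_mat x = mat 1"
  proof -
    have "mat2 ((1 - x) / (u - x)) (- 1 / (u - x)) ((u - 1) / (u - x)) (1 / (u - x)) **
        mat2 1 1 (1 - u) (1 - x) = mat 1" if "u \<noteq> x" for u
      using that by (simp add: mat_1_mat2 divide_simps)
    then show ?thesis
      using x_neq(3) by (simp add: eigen_mat_def eigen_mat_inv_def Let_def del: mat2_mult)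
  qed
  then show "eigen_mat x ** eigen_mat_inv x = mat 1"
    using matrix_left_right_inverse by blast
qed

lemma subgroup_Hgrp: "subgroup (Hgrp F x) SL2"
  unfolding Hgrp_def
  by (rule group_hom.subgroup_img_is_subgroup[OF group_hom_conj2 subgroup_Gam])
    (use eigen_mat_inverse F in auto)

lemma Hgrp_torsion_imp_pm2: "A \<in> Hgrp F x \<Longrightarrow> torsion_imp_pm2 A"
  unfolding Hgrp_def
  using torsion_imp_pm2_conj2 torsion_imp_pm2_Gam[OF F transcendental_over_spar[OF F x]] det_Gam
    eigen_mat_inverse by blast

text \<open>The diagonal matrix is the conjugate of the product of two elementary matrices; halving
  their off-diagonal entries gives square roots in \<open>Gam F (spar x)\<close>.\<close>

lemma Hgrp_diag:
  "mat2 x 0 0 (1 / x) \<in> Hgrp F x"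
  "2 \<noteq> (0 :: 'a) \<Longrightarrow> \<exists>A\<in>Hgrp F x. \<exists>B\<in>Hgrp F x. mat2 x 0 0 (1 / x) = (A ** A) ** (B ** B)"
proof -
  let ?c = "conj2 (eigen_mat_inv x) (eigen_mat x)"
  let ?s = "spar x"
  have s: "?s = (x - 1) * (x - 1) / x"
    using x_neq by (simp add: spar_def field_simps)
  have diag: "?c (mat2 (1 + ?s) 1 ?s 1) = mat2 x 0 0 (1 / x)"
    using x_neq by (simp add: conj_eigen_mat Let_def s divide_simps) (simp add: algebra_simps)
  have "mat2 (1 + ?s) 1 ?s 1 \<in> Gam F ?s"
    by (rule Gam_I[of "[:1, 1:]" _ "[:1:]" "[:0, 1:]" "[:1:]"])
      (auto simp: polys_over_pCons_iff[OF F] polys_over_intros[OF F])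
  then show "mat2 x 0 0 (1 / x) \<in> Hgrp F x"
    unfolding Hgrp_def using diag by (metis imageI)
  assume two: "2 \<noteq> (0 :: 'a)"
  have half: "1 / 2 \<in> F"
    using subfield_setD(2,3,8)[OF F] by (metis one_add_one)
  have "mat2 1 (1 / 2) 0 1 \<in> Gam F ?s"
    by (rule Gam_I[of "[:1:]" _ "[:1/2:]" 0 "[:1:]"])
      (auto simp: polys_over_pCons_iff[OF F] polys_over_intros[OF F] half)
  moreover have "mat2 1 0 (?s / 2) 1 \<in> Gam F ?s"
    by (rule Gam_I[of "[:1:]" _ 0 "[:0, 1/2:]" "[:1:]"])
      (auto simp: polys_over_pCons_iff[OF F] polys_over_intros[OF F] half)
  moreover have "mat2 (1 + ?s) 1 ?s 1 =
      (mat2 1 (1 / 2) 0 1 ** mat2 1 (1 / 2) 0 1) ** (mat2 1 0 (?s / 2) 1 ** mat2 1 0 (?s / 2) 1)"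
    using two by (simp flip: mult_2)
  ultimately show "\<exists>A\<in>Hgrp F x. \<exists>B\<in>Hgrp F x. mat2 x 0 0 (1 / x) = (A ** A) ** (B ** B)"
    unfolding Hgrp_def using diag eigen_mat_inverse by (metis conj2_mult imageI)
qed

text \<open>Provides a field of entries over which a generic \<open>z\<close> can be chosen.\<close>

lemma Hgrp_entries:
  assumes F': "subfield_set F'" "F \<subseteq> F'" "x \<in> F'" and A: "A \<in> Hgrp F x"
  shows "A $ i $ j \<in> F'"
proof -
  note F'_intros = subfield_setD[OF F'(1)]
  have poly_in: "poly p z \<in> F'" if "p \<in> polys_over F" "z \<in> F'" for p z
    using that(1) by (induction p)
      (use F'(2) that(2) in \<open>auto simp: polys_over_pCons_iff[OF F] intro!: F'_intros\<close>)
  have "2 \<in> F'" using F'_intros(2,3) by (metis one_add_one)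
  then have "spar x \<in> F'" using F'(3) unfolding spar_def by (intro F'_intros)
  obtain p q r t where "{p, q, r, t} \<subseteq> polys_over F"
    "A = conj2 (eigen_mat_inv x) (eigen_mat x)
      (mat2 (poly p (spar x)) (poly q (spar x)) (poly r (spar x)) (poly t (spar x)))"
    using A unfolding Hgrp_def by (auto elim!: Gam_E)
  then show ?thesis
    using poly_in[OF _ \<open>spar x \<in> F'\<close>] exhaust_2[of i] exhaust_2[of j] F'(3)
    by (auto simp: conj_eigen_mat Let_def intro!: F'_intros)
qed

text \<open>Fixing one eigenline is a relation between 1 and \<open>1 - 1 / x\<close> (or
  \<open>1 - x\<close>) over \<open>F[s]\<close>. Its coefficients vanish by
  \<open>spar_independent\<close>, so the other eigenline is fixed too. The two eigenvalues have
  product one, and \<open>spar_unit\<close> makes them signed powers of \<open>x\<close>.\<close>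

lemma Hgrp_triangular:
  assumes "A \<in> Hgrp F x" "A $ 1 $ 2 = 0 \<or> A $ 2 $ 1 = 0"
  obtains k e i j where "A = mat2 k 0 0 (1 / k)" "k = e * x ^ i / x ^ j" "e \<in> {1, - 1}"
proof -
  let ?s = "spar x"
  obtain p q r t where B: "p \<in> polys_over F" "q \<in> polys_over F" "r \<in> polys_over F" "t \<in> polys_over F"
    "poly p 0 \<in> {1, - 1}" "poly p ?s * poly t ?s - poly q ?s * poly r ?s = 1"
    and A: "A = conj2 (eigen_mat_inv x) (eigen_mat x) (mat2 (poly p ?s) (poly q ?s) (poly r ?s) (poly t ?s))"
    using assms(1) unfolding Hgrp_def by (auto elim!: Gam_E)
  define a b c d where abcd: "a = poly p ?s" "b = poly q ?s" "c = poly r ?s" "d = poly t ?s"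
  have A': "A = conj2 (eigen_mat_inv x) (eigen_mat x) (mat2 a b c d)" and det: "a * d - b * c = 1"
    using A B(6) by (simp_all add: abcd)
  \<comment> \<open>These equations say that \<open>mat2 a b c d\<close> is a linear combination of
    \<open>mat 1\<close> and \<open>mat2 (1 + ?s) 1 ?s 1\<close>.\<close>
  have cd: "c = b * ?s \<and> d = a - b * ?s"
  proof -
    \<comment> \<open>Stated for \<open>z\<close> so that \<open>z = x\<close> and
      \<open>z = 1 / x\<close>, which share the same \<open>spar\<close>, serve the two
      eigenlines.\<close>
    have *: "c = b * ?s \<and> d = a - b * ?s"
      if z: "transcendental_over F z" "spar z = ?s" and
        eq: "(1 - 1 / z) * (a + b * (1 - 1 / z)) - (c + d * (1 - 1 / z)) = 0" for z
    proof -
      have "z \<noteq> 0" using transcendental_over_neq[OF F z(1)] by simp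
      define y where "y = 1 - 1 / z"
      \<comment> \<open>The slope of an eigenline satisfies a quadratic equation over
        \<open>F[s]\<close>, which makes the relation linear in \<open>y\<close>.\<close>
      have yy: "y * y = ?s - ?s * y"
        unfolding y_def z(2)[symmetric] using \<open>z \<noteq> 0\<close> by (simp add: spar_def field_simps)
      have "(c - b * ?s) + (d - a + b * ?s) * y = b * (y * y - (?s - ?s * y)) - (y * (a + b * y) - (c + d * y))"
        by (simp add: algebra_simps)
      then have eq': "(c - b * ?s) + (d - a + b * ?s) * (1 - 1 / z) = 0"
        using yy eq unfolding y_def by simp
      let ?C = "r - q * [:0, 1:]" and ?D = "t - p + q * [:0, 1:]"
      have "?C \<in> polys_over F" "?D \<in> polys_over F"
        by (intro polys_over_intros[OF F] B; simp add: polys_over_pCons_iff[OF F] polys_over_intros[OF F])+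
      then have "poly ?C (spar z) = 0" "poly ?D (spar z) = 0"
        using spar_independent[OF F z(1), of ?C ?D] eq' unfolding z(2) by (simp_all add: abcd mult.commute)
      then show ?thesis unfolding z(2) by (simp add: abcd algebra_simps)
    qed
    from assms(2) show ?thesis
    proof
      assume "A $ 1 $ 2 = 0"
      then have "(1 - x) * (a + b * (1 - x)) - (c + d * (1 - x)) = 0"
        using x_neq by (simp add: A' conj_eigen_mat Let_def)
      then show ?thesis
        using *[OF transcendental_over_inverse[OF x]] x_neq by (simp add: spar_def)
    next
      assume "A $ 2 $ 1 = 0"
      then have "(1 - 1 / x) * (a + b * (1 - 1 / x)) - (c + d * (1 - 1 / x)) = 0"
        using x_neq by (simp add: A' conj_eigen_mat Let_def)
      then show ?thesis using *[OF x] by simp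
    qed
  qed
  \<comment> \<open>The eigenvalues on the two eigenlines; given \<open>cd\<close>, their product is
    the determinant.\<close>
  define k k' where k: "k = a + b * (1 - 1 / x)" "k' = a + b * (1 - x)"
  have eig: "c + d * (1 - 1 / x) = (1 - 1 / x) * k" "c + d * (1 - x) = (1 - x) * k'"
    unfolding cd[THEN conjunct1] cd[THEN conjunct2] k spar_def using x_neq
    by (simp_all add: field_simps)
  have "k * k' = a * (a - b * ?s) - b * (b * ?s)"
    unfolding k spar_def using x_neq by (simp add: field_simps)
  then have kk': "k * k' = 1" using cd det by simp
  then have "k \<noteq> 0" by auto
  then have k': "k' = 1 / k" using kk' by (simp add: field_simps)
  have "\<exists>i j. k = poly p 0 * x ^ i / x ^ j"
    using spar_unit[OF F x B(1,2)] kk' by (simp add: k abcd)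
  then obtain i j where ij: "k = poly p 0 * x ^ i / x ^ j" by blast
  have "A = mat2 k 0 0 k'"
  proof -
    have "(1 - x) * k - (1 - 1 / x) * k = (1 / x - x) * k" "(1 - x) * k' - (1 - 1 / x) * k' = (1 / x - x) * k'"
      by (simp_all add: algebra_simps)
    then show ?thesis
      using x_neq unfolding A' conj_eigen_mat Let_def eig k[symmetric] by simp
  qed
  then show thesis using that[of k "poly p 0" i j] k' ij B(5) by simp
qed

lemma minus_one_Hgrp: "- mat 1 \<in> Hgrp F x"
proof -
  have "- mat 1 \<in> Gam F (spar x)"
    by (rule Gam_I[of "[:-1:]" _ "[:0:]" "[:0:]" "[:-1:]"])
      (auto simp: polys_over_pCons_iff[OF F] polys_over_intros[OF F] mat_1_mat2)
  moreover have "conj2 (eigen_mat_inv x) (eigen_mat x) (- mat 1) = - mat 1"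
    using eigen_mat_inverse by (simp add: conj2_def uminus_mult_mat2)
  ultimately show ?thesis unfolding Hgrp_def by (metis imageI)
qed

text \<open>The sign \<open>c\<close> serves to move triangular elements between the groups for
  \<open>x\<close> and \<open>- x\<close>.\<close>

lemma diag_powers_Hgrp:
  assumes "e \<in> {1, - 1}" "k = e * (c * x) ^ i / (c * x) ^ j" "c \<in> {1, - 1}"
  shows "mat2 k 0 0 (1 / k) \<in> Hgrp F x"
proof -
  interpret subgroup "Hgrp F x" SL2 by (rule subgroup_Hgrp)
  have neg: "mat2 (- 1) 0 0 (1 / (- 1)) \<in> Hgrp F x" and one: "mat2 1 0 0 (1 / 1) \<in> Hgrp F x"
    using minus_one_Hgrp one_closed by (simp_all add: mat_1_mat2)
  have mult: "mat2 (a * b) 0 0 (1 / (a * b)) \<in> Hgrp F x"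
    if "mat2 a 0 0 (1 / a) \<in> Hgrp F x" "mat2 b 0 0 (1 / b) \<in> Hgrp F x" for a b
    using m_closed[OF that] by simp
  have pow: "mat2 (a ^ n) 0 0 (1 / a ^ n) \<in> Hgrp F x" if "mat2 a 0 0 (1 / a) \<in> Hgrp F x" for a n
    by (induction n) (use one mult[OF that] in auto)
  have inv: "mat2 (inverse a) 0 0 (1 / inverse a) \<in> Hgrp F x"
    if "mat2 a 0 0 (1 / a) \<in> Hgrp F x" "a \<noteq> 0" for a
    using m_inv_closed[OF that(1)] that(2) by (simp add: inv_SL2_mat2 inverse_eq_divide)
  have cx: "mat2 (c * x) 0 0 (1 / (c * x)) \<in> Hgrp F x"
    using assms(3) neg one Hgrp_diag(1) by (intro mult) auto
  have "c * x \<noteq> 0" using assms(3) x_neq by auto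
  then have "mat2 (e * (c * x) ^ i * inverse ((c * x) ^ j)) 0 0 (1 / (e * (c * x) ^ i * inverse ((c * x) ^ j)))
    \<in> Hgrp F x"
    using assms(1) neg one by (intro mult inv pow cx) auto
  then show ?thesis by (simp add: assms(2) divide_inverse)
qed

end

section \<open>Alternating words have a dominating entry\<close>

text \<open>The entries are Laurent polynomials in \<open>z\<close>, multiplied by
  \<open>z ^ n\<close> to become polynomials, so degree \<open>2 * n\<close> encodes Laurent degree
  n. The lower right entry attains degree n, the upper right one may, and the first column stays
  below.\<close>

definition dominated :: "'a::field set \<Rightarrow> 'a \<Rightarrow> ('a^2^2) set" where
  "dominated F z = {A. \<exists>n>0. \<exists>p\<in>polys_over F. \<exists>q\<in>polys_over F. \<exists>r\<in>polys_over F. \<exists>t\<in>polys_over F.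
     Polynomial.degree p < 2 * n \<and> Polynomial.degree q \<le> 2 * n \<and>
     Polynomial.degree r < 2 * n \<and> Polynomial.degree t = 2 * n \<and>
     z ^ n * A $ 1 $ 1 = poly p z \<and> z ^ n * A $ 1 $ 2 = poly q z \<and>
     z ^ n * A $ 2 $ 1 = poly r z \<and> z ^ n * A $ 2 $ 2 = poly t z}"

lemma dominatedI:
  assumes "n > 0" "p \<in> polys_over F" "q \<in> polys_over F" "r \<in> polys_over F" "t \<in> polys_over F"
    "Polynomial.degree p < 2 * n" "Polynomial.degree q \<le> 2 * n"
    "Polynomial.degree r < 2 * n" "Polynomial.degree t = 2 * n"
    "z ^ n * a = poly p z" "z ^ n * b = poly q z" "z ^ n * c = poly r z" "z ^ n * d = poly t z"
  shows "mat2 a b c d \<in> dominated F z"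
  unfolding dominated_def mem_Collect_eq mat2_nth
  by (intro exI[of _ n] bexI[of _ p] bexI[of _ q] bexI[of _ r] bexI[of _ t] conjI assms)

lemma dominatedE:
  assumes "mat2 a b c d \<in> dominated F z"
  obtains n p q r t where
    "n > 0" "p \<in> polys_over F" "q \<in> polys_over F" "r \<in> polys_over F" "t \<in> polys_over F"
    "Polynomial.degree p < 2 * n" "Polynomial.degree q \<le> 2 * n"
    "Polynomial.degree r < 2 * n" "Polynomial.degree t = 2 * n"
    "z ^ n * a = poly p z" "z ^ n * b = poly q z" "z ^ n * c = poly r z" "z ^ n * d = poly t z"
  using assms unfolding dominated_def mem_Collect_eq mat2_nth by blast

text \<open>In the lower right entry \<open>r * q' + t * t'\<close> the second term has strictly
  larger degree, because \<open>r\<close> lies strictly below its bound. Thus the top degrees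
  add.\<close>

lemma dominated_mult:
  assumes F: "subfield_set F" and A: "A \<in> dominated F z" and B: "B \<in> dominated F z"
  shows "A ** B \<in> dominated F z"
proof -
  obtain a b c d where A': "A = mat2 a b c d" by (cases A)
  obtain a' b' c' d' where B': "B = mat2 a' b' c' d'" by (cases B)
  obtain m p q r t where m:
    "m > 0" "p \<in> polys_over F" "q \<in> polys_over F" "r \<in> polys_over F" "t \<in> polys_over F"
    "Polynomial.degree p < 2 * m" "Polynomial.degree q \<le> 2 * m"
    "Polynomial.degree r < 2 * m" "Polynomial.degree t = 2 * m"
    "z ^ m * a = poly p z" "z ^ m * b = poly q z" "z ^ m * c = poly r z" "z ^ m * d = poly t z"
    using A unfolding A' by (rule dominatedE)
  obtain n p' q' r' t' where n:
    "n > 0" "p' \<in> polys_over F" "q' \<in> polys_over F" "r' \<in> polys_over F" "t' \<in> polys_over F"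
    "Polynomial.degree p' < 2 * n" "Polynomial.degree q' \<le> 2 * n"
    "Polynomial.degree r' < 2 * n" "Polynomial.degree t' = 2 * n"
    "z ^ n * a' = poly p' z" "z ^ n * b' = poly q' z" "z ^ n * c' = poly r' z" "z ^ n * d' = poly t' z"
    using B unfolding B' by (rule dominatedE)
  have less: "Polynomial.degree (u * w) < 2 * (m + n)"
    if "Polynomial.degree u + Polynomial.degree w < 2 * (m + n)" for u w :: "'a poly"
    using degree_mult_le[of u w] that by linarith
  have le: "Polynomial.degree (u * w) \<le> 2 * (m + n)"
    if "Polynomial.degree u + Polynomial.degree w \<le> 2 * (m + n)" for u w :: "'a poly"
    using degree_mult_le[of u w] that by linarith
  have "t \<noteq> 0" "t' \<noteq> 0" using m n by auto
  then have tt: "Polynomial.degree (t * t') = 2 * (m + n)"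
    using m n by (simp add: Polynomial.degree_mult_eq)
  have rq: "Polynomial.degree (r * q') < 2 * (m + n)"
    using add_less_le_mono[OF m(8) n(7)] by (intro less) simp
  have scale: "z ^ (m + n) * (u * u' + w * w') = (z ^ m * u) * (z ^ n * u') + (z ^ m * w) * (z ^ n * w')"
    for u u' w w' by (simp add: power_add algebra_simps)
  show ?thesis
    unfolding A' B' mat2_mult
  proof (rule dominatedI[of "m + n" "p * p' + q * r'" _ "p * q' + q * t'" "r * p' + t * r'" "r * q' + t * t'"])
    show "Polynomial.degree (p * p' + q * r') < 2 * (m + n)" "Polynomial.degree (r * p' + t * r') < 2 * (m + n)"
      by (intro degree_add_less less; use m(6-9) n(6-9) in simp)+
    show "Polynomial.degree (p * q' + q * t') \<le> 2 * (m + n)"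
      by (intro degree_add_le le; use m(6-9) n(6-9) in simp)
    show "Polynomial.degree (r * q' + t * t') = 2 * (m + n)"
      using degree_add_eq_right[of "r * q'" "t * t'"] rq tt by simp
  qed (use m n in \<open>auto intro!: polys_over_intros[OF F] simp: scale\<close>)
qed

text \<open>Powers stay dominated, whereas a scalar matrix over \<open>F\<close> is not:
  \<open>z ^ n * c\<close> would be a polynomial value of degree \<open>2 * n\<close>, against
  transcendence. So no positive power is plus or minus the identity.\<close>

lemma torsion_imp_pm2_dominated:
  assumes F: "subfield_set F" and z: "transcendental_over F z" and A: "A \<in> dominated F z"
  shows "torsion_imp_pm2 A"
proof -
  have pm: "mat2 c 0 0 c \<notin> dominated F z" if "c \<in> F" for c
  proof
    assume "mat2 c 0 0 c \<in> dominated F z"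
    then obtain n t where t: "n > 0" "t \<in> polys_over F" "Polynomial.degree t = 2 * n" "z ^ n * c = poly t z"
      by (rule dominatedE)
    have "t - Polynomial.monom c n = 0"
      using t that by (intro transcendental_overD[OF z] polys_over_intros[OF F])
        (auto simp: poly_monom mult.commute)
    then show False using t degree_monom_le[of c n] by simp
  qed
  have "A [^]\<^bsub>SL2\<^esub> Suc n \<in> dominated F z" for n
    by (induction n) (use A dominated_mult[OF F] in auto)
  then have "A [^]\<^bsub>SL2\<^esub> n \<noteq> mat 1 \<and> A [^]\<^bsub>SL2\<^esub> n \<noteq> - mat 1" if "n > 0" for n :: nat
    using pm[of 1] pm[of "- 1"] subfield_setD(2,5)[OF F] that
    by (metis gr0_implies_Suc mat_1_mat2 minus_zero uminus_mat2)
  then show ?thesis unfolding torsion_imp_pm2_def by blast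
qed

text \<open>Conjugation multiplies the upper right entry of \<open>B\<close> by \<open>z\<close> and
  divides the lower left one by \<open>z\<close>. The lower right entry of the product therefore has
  the nonzero leading term \<open>z * A $ 2 $ 1 * B $ 1 $ 2\<close>, and n = 1 works.\<close>

lemma mult_conj_diag_dominated:
  fixes A B :: "'a::field^2^2"
  assumes F: "subfield_set F" and z: "z \<noteq> 0"
    and A: "\<And>i j. A $ i $ j \<in> F" "A $ 2 $ 1 \<noteq> 0" and B: "\<And>i j. B $ i $ j \<in> F" "B $ 1 $ 2 \<noteq> 0"
  shows "A ** conj2 (mat2 z 0 0 1) (mat2 (1 / z) 0 0 1) B \<in> dominated F z"
proof -
  obtain a b c d where A': "A = mat2 a b c d" by (cases A)
  obtain a' b' c' d' where B': "B = mat2 a' b' c' d'" by (cases B)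
  have in_F: "a \<in> F" "b \<in> F" "c \<in> F" "d \<in> F" "a' \<in> F" "b' \<in> F" "c' \<in> F" "d' \<in> F"
    using A(1)[of 1 1] A(1)[of 1 2] A(1)[of 2 1] A(1)[of 2 2]
      B(1)[of 1 1] B(1)[of 1 2] B(1)[of 2 1] B(1)[of 2 2] by (simp_all add: A' B')
  have nz: "c \<noteq> 0" "b' \<noteq> 0" using A(2) B(2) by (simp_all add: A' B')
  have "A ** conj2 (mat2 z 0 0 1) (mat2 (1 / z) 0 0 1) B =
      mat2 (a * a' + b * (c' / z)) (a * (z * b') + b * d') (c * a' + d * (c' / z)) (c * (z * b') + d * d')"
    using z by (simp add: A' B' conj2_def)
  also have "\<dots> \<in> dominated F z"
    by (rule dominatedI[of 1 "[:b * c', a * a':]" _ "[:0, b * d', a * b':]" "[:d * c', c * a':]" "[:0, d * d', c * b':]"])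
      (use in_F z nz in \<open>auto simp: polys_over_pCons_iff[OF F] polys_over_0[OF F] field_simps
        intro: subfield_setD[OF F]\<close>)
  finally show ?thesis .
qed

section \<open>The non-liftable group\<close>

text \<open>A lift is determined up to sign, and the sign disappears on squares.\<close>

lemma lift_prod_squares:
  fixes \<Gamma> :: "('a::field^2^2) set"
  assumes \<Gamma>: "subgroup \<Gamma> SL2" and \<phi>: "\<phi> \<in> hom (PSL2\<lparr>carrier := proj_PSL2 ` \<Gamma>\<rparr>) SL2"
    and lift: "\<And>g. g \<in> proj_PSL2 ` \<Gamma> \<Longrightarrow> proj_PSL2 (\<phi> g) = g"
    and A: "A \<in> \<Gamma>" "B \<in> \<Gamma>"
  shows "\<phi> (proj_PSL2 ((A ** A) ** (B ** B))) = (A ** A) ** (B ** B)"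
proof -
  interpret \<Gamma>: subgroup \<Gamma> SL2 by fact
  have mult: "\<phi> (proj_PSL2 (C ** D)) = \<phi> (proj_PSL2 C) ** \<phi> (proj_PSL2 D)" if "C \<in> \<Gamma>" "D \<in> \<Gamma>" for C D
  proof -
    have "proj_PSL2 (C ** D) = proj_PSL2 C \<otimes>\<^bsub>PSL2\<^esub> proj_PSL2 D"
      using group_hom.hom_mult[OF group_hom_proj, of C D] that[THEN \<Gamma>.mem_carrier] by simp
    then show ?thesis
      using that Group.hom_mult[OF \<phi>, of "proj_PSL2 C" "proj_PSL2 D"] by simp
  qed
  have sq: "\<phi> (proj_PSL2 (C ** C)) = C ** C" if "C \<in> \<Gamma>" for C
  proof -
    have "\<phi> (proj_PSL2 C) = C \<or> \<phi> (proj_PSL2 C) = - C"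
      using lift[of "proj_PSL2 C"] that by (auto simp: proj_PSL2_eq_iff)
    then show ?thesis using mult[OF that that] by auto
  qed
  have "C ** C \<in> \<Gamma>" if "C \<in> \<Gamma>" for C
    using \<Gamma>.m_closed[OF that that] by simp
  then show ?thesis using A mult[of "A ** A" "B ** B"] sq by simp
qed

theorem theoremC:
  fixes v :: "'a::field \<Rightarrow> real"
  assumes "nonarch_local_field v"
    and "CHAR('a) \<noteq> 2"
  shows "\<exists>G :: ('a ^2^2) set set.
           subgroup G PSL2 \<and> \<not> lifts_to_SL2 G \<and>
           (\<forall>g\<in>G. torsion_PSL2 g \<and> g \<noteq> \<one>\<^bsub>PSL2\<^esub> \<longrightarrow> unipotent_PSL2 g) \<and>
           (CHAR('a) = 0 \<longrightarrow> (\<forall>g\<in>G. torsion_PSL2 g \<longrightarrow> g = \<one>\<^bsub>PSL2\<^esub>)) \<and>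
           (CHAR('a) > 0 \<longrightarrow>
              (\<forall>g\<in>G. torsion_PSL2 g \<and> g \<noteq> \<one>\<^bsub>PSL2\<^esub> \<longrightarrow>
                 group.ord (PSL2 :: ('a ^2^2) set monoid) g = CHAR('a)))"
proof -

  \<comment> \<open>Choice of the fields and of the generic elements\<close>
  have unc: "uncountable (UNIV :: 'a set)"
    by (rule local_field_uncountable) fact
  have two: "(2 :: 'a) \<noteq> 0"
    using assms(2) by (rule two_neq_0_CHAR)
  obtain F :: "'a set" where F: "subfield_set F" "countable F"
    using countable_subfield_exists[of "{}"] by auto
  obtain x where x: "transcendental_over F x"
    using transcendental_exists[OF unc F(2)] by blast
  have x': "transcendental_over F (- x)"
    by (rule transcendental_over_uminus[OF F(1) x])
  \<comment> \<open>\<open>F'\<close> holds the entries of both groups before the second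
    conjugation, so \<open>z\<close> is independent of all of them.\<close>
  obtain F' where F': "subfield_set F'" "countable F'" "insert x F \<subseteq> F'"
    using countable_subfield_exists[of "insert x F"] F(2) by auto
  obtain z where z: "transcendental_over F' z"
    using transcendental_exists[OF unc F'(2)] by blast
  have z0: "z \<noteq> 0" using transcendental_over_neq[OF F'(1) z] by simp
  have x_F': "x \<in> F'" "- x \<in> F'" "F \<subseteq> F'" using F'(3) subfield_setD(5)[OF F'(1)] by auto

  \<comment> \<open>The two vertex groups and their cross products\<close>
  let ?D = "mat2 z 0 0 1" and ?D' = "mat2 (1 / z) 0 0 1"
  have D: "?D ** ?D' = mat 1" "?D' ** ?D = mat 1"
    using z0 by (simp_all add: mat_1_mat2)
  have D_diag: "conj2 ?D ?D' (mat2 a 0 0 d) = mat2 a 0 0 d" for a d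
    using z0 by (simp add: conj2_def)
  interpret conj: group_hom SL2 SL2 "conj2 ?D ?D'"
    by (rule group_hom_conj2) fact
  define H1 where "H1 = Hgrp F x"
  define H2 where "H2 = conj2 ?D ?D' ` Hgrp F (- x)"
  have H1: "subgroup H1 SL2" unfolding H1_def by (rule subgroup_Hgrp[OF F(1) x])
  have H2: "subgroup H2 SL2"
    unfolding H2_def by (rule conj.subgroup_img_is_subgroup[OF subgroup_Hgrp[OF F(1) x']])
  have cross: "A ** B \<in> dominated F' z" if A: "A \<in> H1 - H2" and B: "B \<in> H2 - H1" for A B
  proof -
    obtain B' where B': "B' \<in> Hgrp F (- x)" "B = conj2 ?D ?D' B'"
      using B by (auto simp: H2_def)
    have A': "A \<in> Hgrp F x" using A by (simp add: H1_def)
    \<comment> \<open>A triangular element of either group is diagonal with signed powers of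
      \<open>x\<close>, lies in the other group as well and is fixed by the conjugation; elements
      outside the intersection are thus not triangular.\<close>
    have "A $ 2 $ 1 \<noteq> 0"
    proof
      assume "A $ 2 $ 1 = 0"
      then obtain k e i j where k: "A = mat2 k 0 0 (1 / k)" "k = e * x ^ i / x ^ j" "e \<in> {1, - 1}"
        using Hgrp_triangular[OF F(1) x A'] by blast
      have "A \<in> Hgrp F (- x)"
        unfolding k(1) by (rule diag_powers_Hgrp[OF F(1) x', of e _ "- 1" i j]) (use k in auto)
      then have "A \<in> H2" unfolding H2_def using D_diag k(1) by (metis imageI)
      then show False using A by simp
    qed
    moreover have "B' $ 1 $ 2 \<noteq> 0"
    proof
      assume "B' $ 1 $ 2 = 0"
      then obtain k e i j where k: "B' = mat2 k 0 0 (1 / k)" "k = e * (- x) ^ i / (- x) ^ j" "e \<in> {1, - 1}"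
        using Hgrp_triangular[OF F(1) x' B'(1)] by blast
      have "B' \<in> H1"
        unfolding H1_def k(1) by (rule diag_powers_Hgrp[OF F(1) x, of e _ "- 1" i j]) (use k in auto)
      then show False using B B'(2) D_diag k(1) by simp
    qed
    moreover have "A $ i $ j \<in> F'" "B' $ i $ j \<in> F'" for i j
      using Hgrp_entries[OF F(1) x F'(1) x_F'(3,1)] Hgrp_entries[OF F(1) x' F'(1) x_F'(3,2)] A' B'(1)
      by auto
    ultimately show ?thesis
      unfolding B'(2) using z0 by (intro mult_conj_diag_dominated F'(1)) auto
  qed

  \<comment> \<open>Torsion in the generated group\<close>
  define \<Gamma> where "\<Gamma> = generate SL2 (H1 \<union> H2)"
  have H_SL2: "H1 \<union> H2 \<subseteq> carrier SL2"
    using H1 H2 subgroup.subset by blast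
  have \<Gamma>: "subgroup \<Gamma> SL2"
    unfolding \<Gamma>_def by (rule SL2.generate_is_subgroup) fact
  have \<Gamma>_det: "det A = 1" if "A \<in> \<Gamma>" for A
    using subgroup.subset[OF \<Gamma>] that by auto
  have H_tors: "torsion_imp_pm2 A" if "A \<in> H1 \<union> H2 \<union> dominated F' z" for A
    using that
  proof (elim UnE)
    assume "A \<in> H1"
    then show ?thesis unfolding H1_def by (rule Hgrp_torsion_imp_pm2[OF F(1) x])
  next
    assume "A \<in> H2"
    then obtain B where "B \<in> Hgrp F (- x)" "A = conj2 ?D ?D' B" by (auto simp: H2_def)
    then show ?thesis
      using Hgrp_torsion_imp_pm2[OF F(1) x'] torsion_imp_pm2_conj2[OF _ _ D(1)]
        subgroup.subset[OF subgroup_Hgrp[OF F(1) x']] by auto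
  next
    assume "A \<in> dominated F' z"
    then show ?thesis by (rule torsion_imp_pm2_dominated[OF F'(1) z])
  qed
  have \<Gamma>_tors: "torsion_imp_pm2 A" if A: "A \<in> \<Gamma>" for A
  proof -
    \<comment> \<open>Some conjugate lies in a vertex group or is dominated, where
      \<open>H_tors\<close> applies; conjugating back preserves the conclusion.\<close>
    obtain k where k: "k \<in> carrier SL2" "inv\<^bsub>SL2\<^esub> k ** A ** k \<in> H1 \<union> H2 \<union> dominated F' z"
      using group.generate_union_conj[OF group_SL2 H1 H2, of "dominated F' z" A] dominated_mult[OF F'(1)] cross A
      by (auto simp: \<Gamma>_def)
    let ?k' = "inv\<^bsub>SL2\<^esub> k"
    have kk': "k ** ?k' = mat 1" "?k' ** k = mat 1"
      using SL2.r_inv[OF k(1)] SL2.l_inv[OF k(1)] by simp_all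
    have "torsion_imp_pm2 (conj2 k ?k' (conj2 ?k' k A))"
    proof (rule torsion_imp_pm2_conj2)
      show "torsion_imp_pm2 (conj2 ?k' k A)"
        using H_tors[OF k(2)] by (simp add: conj2_def)
      show "det (conj2 ?k' k A) = 1"
        using group_hom.hom_closed[OF group_hom_conj2[OF kk'(2)], of A] \<Gamma>_det[OF A] by simp
    qed (rule kk')
    then show ?thesis by (simp add: conj2_inverse[OF kk'(1)])
  qed

  interpret proj: group_hom SL2 PSL2 "proj_PSL2 :: 'a^2^2 \<Rightarrow> _" by (rule group_hom_proj)
  have tors: "unipotent_PSL2 g \<and> CHAR('a) > 0 \<and> group.ord PSL2 g = CHAR('a)"
    if g: "g \<in> proj_PSL2 ` \<Gamma>" "torsion_PSL2 g" "g \<noteq> \<one>\<^bsub>PSL2\<^esub>" for g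
  proof -
    obtain A where A: "A \<in> \<Gamma>" "g = proj_PSL2 A" using g(1) by auto
    obtain n :: nat where "n > 0" "proj_PSL2 A [^]\<^bsub>PSL2\<^esub> n = \<one>\<^bsub>PSL2\<^esub>"
      using g(2) unfolding torsion_PSL2_def A(2) by auto
    then have "tr2 A = 2 \<or> tr2 A = - 2"
      using \<Gamma>_tors[OF A(1)] \<Gamma>_det[OF A(1)]
      by (auto simp: torsion_imp_pm2_def proj_PSL2_pow proj_PSL2_eq_one_iff)
    then show ?thesis
      using torsion_trace_pm2[OF assms(2) \<Gamma>_det[OF A(1)]] g unfolding A(2) by blast
  qed

  \<comment> \<open>Absence of a lift\<close>
  have "\<not> lifts_to_SL2 (proj_PSL2 ` \<Gamma>)"
  proof
    assume "lifts_to_SL2 (proj_PSL2 ` \<Gamma>)"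
    then obtain \<phi> where \<phi>: "\<phi> \<in> hom (PSL2\<lparr>carrier := proj_PSL2 ` \<Gamma>\<rparr>) SL2"
      "\<And>g. g \<in> proj_PSL2 ` \<Gamma> \<Longrightarrow> proj_PSL2 (\<phi> g) = g"
      unfolding lifts_to_SL2_def by blast
    let ?T = "mat2 x 0 0 (1 / x)"
    have H_\<Gamma>: "H1 \<union> H2 \<subseteq> \<Gamma>" unfolding \<Gamma>_def by (auto intro: generate.incl)
    obtain A B where AB: "A \<in> H1" "B \<in> H1" "?T = (A ** A) ** (B ** B)"
      using Hgrp_diag(2)[OF F(1) x two] unfolding H1_def by blast
    then have \<phi>_T: "\<phi> (proj_PSL2 ?T) = ?T"
      unfolding AB(3) using H_\<Gamma> by (intro lift_prod_squares[OF \<Gamma> \<phi>(1)] \<phi>(2)) auto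
    obtain A' B' where AB': "A' \<in> Hgrp F (- x)" "B' \<in> Hgrp F (- x)"
      "mat2 (- x) 0 0 (1 / - x) = (A' ** A') ** (B' ** B')"
      using Hgrp_diag(2)[OF F(1) x' two] by blast
    let ?c = "conj2 ?D ?D'"
    have "- ?T = ?c (mat2 (- x) 0 0 (1 / - x))"
      by (simp add: D_diag)
    also have "\<dots> = (?c A' ** ?c A') ** (?c B' ** ?c B')"
      unfolding AB'(3) by (simp only: conj2_mult[OF D(2)])
    finally have T: "- ?T = (?c A' ** ?c A') ** (?c B' ** ?c B')" .
    have "?c A' \<in> \<Gamma>" "?c B' \<in> \<Gamma>" using AB' H_\<Gamma> by (auto simp: H2_def)
    then have "\<phi> (proj_PSL2 (- ?T)) = - ?T"
      unfolding T by (intro lift_prod_squares[OF \<Gamma> \<phi>(1)] \<phi>(2))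
    moreover have "proj_PSL2 (- ?T) = proj_PSL2 ?T"
      by (simp only: proj_PSL2_eq_iff) simp
    ultimately have "?T = - ?T" using \<phi>_T by metis
    then have "x = - x" by simp
    then have "2 * x = 0" by (metis add.right_inverse mult_2)
    then show False
      using two transcendental_over_neq(1)[OF F(1) x] by simp
  qed
  moreover have "subgroup (proj_PSL2 ` \<Gamma>) PSL2"
    by (rule proj.subgroup_img_is_subgroup[OF \<Gamma>])
  \<comment> \<open>A nontrivial torsion element would force positive characteristic by
    \<open>tors\<close>.\<close>
  moreover have "g = \<one>\<^bsub>PSL2\<^esub>"
    if "g \<in> proj_PSL2 ` \<Gamma>" "torsion_PSL2 g" "CHAR('a) = 0" for g
    using tors[OF that(1,2)] that(3) by force
  ultimately show ?thesis
    using tors by blast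
qed

end
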